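(* For all $j,f\ge0$, $$F_{j,f}(t)=\sum_{k\ge0}\gamma_{j,f,k}\,t^k(1+t)^{2j+f-2k},$$ where $$\gamma_{j,f,k}=\sum_{r=0}^{f}A_{j,k,r}\binom fr,\qquad A_{j,k,r}\in\mathbb N.$$ Consequently, for every $n\ge0$ there exist polynomials $C_{n,k}(p)\in\mathbb N[p]$ such that $$\mathcal F_n(p,t)=\sum_{k=0}^{\lfloor n/2\rfloor}C_{n,k}(p)\,t^k(1+t)^{n-2k}.$$
   Context: $\mathbb N=\{0,1,2,\dots\}$. For $n\ge1$, $\mathfrak B_n$ is the hyperoctahedral group of signed permutations: words $\pi=\pi_1\cdots\pi_n$ of nonzero integers such that $|\pi_1|,\dots,|\pi_n|$ is a permutation of $[n]=\{1,\dots,n\}$, with $\pi(i)=\pi_i$, $\pi(-i)=-\pi(i)$. $\mathcal I_n^B$ is the set of $\pi\in\mathfrak B_n$ with $\pi^2=\mathrm{id}$ (for $n=0$, a single empty involution). With $\pi_0=0$ and the usual order on $\mathbb Z$, $\operatorname{des}^B(\pi)=\#\{0\le i\le n-1:\pi_i>\pi_{i+1}\}$. $\operatorname{fix}_B(\pi)=\#\{i\in[n]:|\pi(i)|=i\}$, and $\operatorname{cyc}_2(\pi)$ is the number of two-cycles of the ordinary involution $i\mapsto|\pi(i)|$ of $[n]$. $$\mathcal F_n(p,t)=\sum_{\pi\in\mathcal I_n^B}p^{\operatorname{fix}_B(\pi)}t^{\operatorname{des}^B(\pi)},\qquad F_{j,f}(t)=\sum_{\substack{\pi\in\mathcal I_{2j+f}^B\\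 \operatorname{cyc}_2(\pi)=j,\ \operatorname{fix}_B(\pi)=f}}t^{\operatorname{des}^B(\pi)}.$$ Let $J_{2j}^B(t)=F_{j,0}(t)$ and let $P_j(x)=\sum_{s=0}^jD_{2j,s}x^s$ be the unique polynomial with $J_{2j}^B(t)=(1+t)^{2j}P_j\!\left(\frac{t}{(1+t)^2}\right)$. The following is a known theorem of Wan, Gao, Li and Yang taken as given: $P_j$ exists and $D_{2j,s}\in\mathbb N$. The numbers $A_{j,k,r}$ are the coefficients of $x^k$ in the polynomials $A_{j,r}(x)=\sum_kA_{j,k,r}x^k$ defined by $$\sum_{r\ge0}A_{j,r}(x)W^r=(1+4xW)^{2j}\,P_j\!\left(\frac{x(1+2W+4xW^2)}{(1+4xW)^2}\right).$$ *)

theory Defs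
  imports "HOL-Computational_Algebra.Computational_Algebra"
begin

section \<open>Signed permutations\<close>

text \<open>
  A signed permutation \<open>\<pi>\<^sub>1 \<dots> \<pi>\<^sub>n\<close> is represented by the odd function \<open>\<pi> :: int \<Rightarrow> int\<close> that is
  the identity beyond \<open>n\<close>, so that distinct words correspond to distinct functions. Oddness gives
  \<open>\<pi> 0 = 0\<close>, which is the convention \<open>\<pi>\<^sub>0 = 0\<close> used for descents. For \<open>n = 0\<close> only the
  identity remains (the empty word).
\<close>

definition signed_perms :: "nat \<Rightarrow> (int \<Rightarrow> int) set" where
  "signed_perms n =
     {\<pi>. bij_betw (\<lambda>i. \<bar>\<pi> i\<bar>) {1..int n} {1..int n} \<and>
         (\<forall>i. \<pi> (- i) = - \<pi> i) \<and>
         (\<forall>i > int n. \<pi> i = i)}"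

definition involutions_B :: "nat \<Rightarrow> (int \<Rightarrow> int) set" where
  "involutions_B n = {\<pi> \<in> signed_perms n. \<pi> \<circ> \<pi> = id}"

definition des_B :: "nat \<Rightarrow> (int \<Rightarrow> int) \<Rightarrow> nat" where
  "des_B n \<pi> = card {i \<in> {0..<int n}. \<pi> i > \<pi> (i + 1)}"

definition fix_B :: "nat \<Rightarrow> (int \<Rightarrow> int) \<Rightarrow> nat" where
  "fix_B n \<pi> = card {i \<in> {1..int n}. \<bar>\<pi> i\<bar> = i}"

text \<open>The two-cycles of the involution \<open>i \<mapsto> \<bar>\<pi> i\<bar>\<close> are counted as two-element orbits.\<close>

definition cyc2 :: "nat \<Rightarrow> (int \<Rightarrow> int) \<Rightarrow> nat" where
  "cyc2 n \<pi> = card {{i, \<bar>\<pi> i\<bar>} | i. i \<in> {1..int n} \<and> \<bar>\<pi> i\<bar> \<noteq> i}"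

section \<open>Descent polynomials of involutions\<close>

text \<open>Polynomials in \<open>t\<close> whose coefficients are polynomials in \<open>p\<close>.\<close>

definition F_inv :: "nat \<Rightarrow> int poly poly" where
  "F_inv n = (\<Sum>\<pi>\<in>involutions_B n. monom (monom 1 (fix_B n \<pi>)) (des_B n \<pi>))"

definition F_cyc_fix :: "nat \<Rightarrow> nat \<Rightarrow> int poly" where
  "F_cyc_fix j f =
     (\<Sum>\<pi> | \<pi> \<in> involutions_B (2 * j + f) \<and>
            cyc2 (2 * j + f) \<pi> = j \<and> fix_B (2 * j + f) \<pi> = f.
        monom 1 (des_B (2 * j + f) \<pi>))"

definition J_B :: "nat \<Rightarrow> int poly" where
  "J_B j = F_cyc_fix j 0"

section \<open>The polynomials \<open>P\<^sub>j\<close> and \<open>A\<^sub>j\<^sub>,\<^sub>r\<close>\<close>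

text \<open>\<open>J\<^sub>2\<^sub>j(t) = (1+t)^(2j) P(t/(1+t)\<^sup>2)\<close> as an identity of rational functions in \<open>t\<close>.\<close>

definition is_P :: "nat \<Rightarrow> int poly \<Rightarrow> bool" where
  "is_P j P \<longleftrightarrow> degree P \<le> j \<and>
     (let t = to_fract [:0, 1:] :: int poly fract
      in to_fract (J_B j) =
           (1 + t) ^ (2 * j) * poly (map_poly of_int P) (t / (1 + t) ^ 2))"

definition P_poly :: "nat \<Rightarrow> int poly" where
  "P_poly j = (THE P. is_P j P)"

text \<open>
  The generating function of the \<open>A\<^sub>j\<^sub>,\<^sub>r(x)\<close> lives in formal power series in \<open>W\<close> over the rational
  functions in \<open>x\<close>. The denominator \<open>(1+4xW)\<^sup>2\<close> has constant term \<open>1\<close>, so the division is exact.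
\<close>

definition A_genfun :: "nat \<Rightarrow> int poly fract fps" where
  "A_genfun j =
     (let x = fps_const (to_fract [:0, 1:]); W = fps_X
      in (1 + 4 * x * W) ^ (2 * j) *
         poly (map_poly of_int (P_poly j))
           (x * (1 + 2 * W + 4 * x * W ^ 2) / (1 + 4 * x * W) ^ 2))"

definition A_poly :: "nat \<Rightarrow> nat \<Rightarrow> int poly" where
  "A_poly j = (THE A. Abs_fps (\<lambda>r. to_fract (A r)) = A_genfun j)"

definition A_coeff :: "nat \<Rightarrow> nat \<Rightarrow> nat \<Rightarrow> int" where
  "A_coeff j k r = coeff (A_poly j r) k"

definition gamma_coeff :: "nat \<Rightarrow> nat \<Rightarrow> nat \<Rightarrow> int" where
  "gamma_coeff j f k = (\<Sum>r=0..f. A_coeff j k r * int (f choose r))"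

end

(*
  Label the positions of an involution pi in B_n by a weakly increasing sequence
  0 = s_0 <= s_1 <= ... <= s_n <= m that increases strictly at every descent of pi. For a fixed pi
  the numbers of such labellings have generating function t^des(pi) / (1 - t)^(n+1) in m. On the
  other hand the pair (pi, s) is determined by the multiset of the cells (s_i, s_(pi i)), where s is
  extended to an odd function, and the multisets that occur are those that are symmetric under
  swapping coordinates. The fixed points of pi are the diagonal cells (a, a) with 0 <= a <= m,
  together with the antidiagonal cells (a, -a), 1 <= a <= m, of odd multiplicity. Splitting them off
  gives the factor (1 + v)^m / (1 - v)^(m+1), so that

    sum_f F_(j,f)(t) v^f / (1 - t)^(2j+f+1) = sum_m [t^m](J(t) / (1 - t)^(2j+1)) * t^m (1 + v)^m / (1 - v)^(m+1),

  that is, J(t) / (1 - t)^(2j+1) under the substitution t -> t (1 + v) / (1 - v), divided by 1 - v.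
  Inserting J(t) = (1 + t)^(2j) P(t / (1 + t)^2) and rescaling v yields the generating function that
  defines the A_(j,r), with W = z / (1 - z), z = (1 + t) v. Positivity and the vanishing for
  2k > 2j + r are read off the expansion of that generating function, as P has degree at most j.
*)
theory Submission
  imports Defs "HOL-Library.Product_Lexorder" "HOL-Library.Product_Plus"
begin

text \<open>Given weakly increasing labels, strict increase at descents says exactly that the pairs
  (s_i, \<pi>_i) increase lexicographically; so \<pi> is increasing on positions with equal labels.
  It therefore matches each fibre of the cell map monotonically with the fibre of the swapped cell,
  and can be rebuilt from ranks within fibres. Positions run over all of -n..n, so that oddness of
  \<pi> becomes reversal of ranks; position 0 then belongs to the fibre of the cell (0, 0). The
  parity condition has the same source: swapping (a, -a) gives its negative, so the matching
  reverses the fibre against its mirror image, and only a middle element can satisfy \<pi> i = -i.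
  On the algebraic side the obstacle is division, in several rings. Replacing b^(2j) P(a / b^2) by
  the form \<open>qform j D a b\<close> makes every substitution an application of a ring
  homomorphism. Rescaling v by 1 - t absorbs the dependence on f of the denominators (1 -
  t)^(2j+f+1). The binomials arise because W^r / (1 - z) has v^f coefficient (f choose r) (1 +
  t)^f.\<close>

unbundle fps_syntax

section \<open>Labelled involutions and their cells\<close>

definition odd_ext :: "(nat \<Rightarrow> int) \<Rightarrow> int \<Rightarrow> int" where
  "odd_ext s i = sgn i * s (nat \<bar>i\<bar>)"

text \<open>Vanishing beyond \<open>n\<close> makes each labelling a unique function, so that
  labellings can be counted. The predicate \<open>D\<close> is abstract because the count depends
  only on the size of the descent set.\<close>

definition labellings :: "nat \<Rightarrow> (nat \<Rightarrow> bool) \<Rightarrow> nat \<Rightarrow> (nat \<Rightarrow> int) set" where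
  "labellings n D m = {s. s 0 = 0 \<and> (\<forall>i>n. s i = 0) \<and> s n \<le> int m \<and>
     (\<forall>i<n. s i \<le> s (Suc i) \<and> (D i \<longrightarrow> s i < s (Suc i)))}"

definition descent_at :: "(int \<Rightarrow> int) \<Rightarrow> nat \<Rightarrow> bool" where
  "descent_at \<pi> i \<longleftrightarrow> \<pi> (int i) > \<pi> (int i + 1)"

text \<open>Zero-based position of \<open>i\<close> inside its fibre under \<open>W\<close>. The
  window is symmetric about 0 so that negation acts on fibres.\<close>

definition rank :: "nat \<Rightarrow> (int \<Rightarrow> int \<times> int) \<Rightarrow> int \<Rightarrow> nat" where
  "rank n W i = card {x \<in> {- int n..int n}. W x = W i \<and> x < i}"

definition cell :: "(int \<Rightarrow> int) \<Rightarrow> (nat \<Rightarrow> int) \<Rightarrow> int \<Rightarrow> int \<times> int" where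
  "cell \<pi> s i = (odd_ext s i, odd_ext s (\<pi> i))"

section \<open>Ranks in the fibres of a map on a symmetric interval\<close>

lemma strict_step_less:
  fixes f :: "int \<Rightarrow> 'a :: preorder"
  assumes "\<And>i. a \<le> i \<Longrightarrow> i < b \<Longrightarrow> f i < f (i + 1)" "a \<le> i" "i < j" "j \<le> b"
  shows "f i < f j"
proof -
  have "j \<le> b \<longrightarrow> f i < f j" if "i < j" for j
    using that
  proof (induction j rule: int_gr_induct)
    case base
    then show ?case using assms by auto
  next
    case (step k)
    then show ?case using assms(1)[of k] assms(2) by (auto intro: less_trans)
  qed
  then show ?thesis using assms by blast
qed

lemma finite_int_interval_Collect [simp]: "finite {x. - int n \<le> x \<and> x \<le> int n \<and> P x}"
  by (rule finite_subset[of _ "{- int n..int n}"]) auto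

lemma rank_less:
  assumes "x \<in> {- int n..int n}" "W x = W y" "x < y"
  shows "rank n W x < rank n W y"
  unfolding rank_def using assms by (intro psubset_card_mono) auto

lemma rank_inj:
  assumes "x \<in> {- int n..int n}" "y \<in> {- int n..int n}" "W x = W y" "rank n W x = rank n W y"
  shows "x = y"
  using assms rank_less[of x n W y] rank_less[of y n W x] by (metis less_irrefl linorder_neqE)

lemma rank_bij_betw:
  "bij_betw (rank n W) {x \<in> {- int n..int n}. W x = c} {..<card {x \<in> {- int n..int n}. W x = c}}"
proof -
  let ?C = "{x \<in> {- int n..int n}. W x = c}"
  have inj: "inj_on (rank n W) ?C"
    by (rule inj_onI) (metis (mono_tags, lifting) mem_Collect_eq rank_inj)
  have sub: "rank n W ` ?C \<subseteq> {..<card ?C}"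
    unfolding rank_def by (auto intro!: psubset_card_mono)
  have "rank n W ` ?C = {..<card ?C}"
    by (rule card_subset_eq[OF _ sub]) (use card_image[OF inj] in simp_all)
  then show ?thesis using inj by (simp add: bij_betw_def)
qed

text \<open>Negation carries the fibre of \<open>W i\<close> onto that of \<open>- W i\<close> and
  reverses order, so the rank of \<open>- i\<close> counts the elements of the fibre of
  \<open>i\<close> that lie above \<open>i\<close>.\<close>

lemma rank_uminus:
  assumes odd: "\<And>x. W (- x) = - W x" and i: "i \<in> {- int n..int n}"
  shows "rank n W (- i) + rank n W i + 1 = card {x \<in> {- int n..int n}. W x = W i}"
proof -
  have "bij_betw uminus {x \<in> {- int n..int n}. W x = W i \<and> x > i} {x \<in> {- int n..int n}. W x = W (- i) \<and> x < - i}"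
    by (rule bij_betw_byWitness[where f' = uminus]) (auto simp: odd)
  from bij_betw_same_card[OF this] have 1: "rank n W (- i) = card {x \<in> {- int n..int n}. W x = W i \<and> x > i}"
    by (simp add: rank_def)
  have "card {x \<in> {- int n..int n}. W x = W i} =
      card ({x \<in> {- int n..int n}. W x = W i \<and> x > i} \<union> ({x \<in> {- int n..int n}. W x = W i \<and> x < i} \<union> {i}))"
    using i by (intro arg_cong[where f = card]) auto
  also have "\<dots> = card {x \<in> {- int n..int n}. W x = W i \<and> x > i} + card ({x \<in> {- int n..int n}. W x = W i \<and> x < i} \<union> {i})"
    by (rule card_Un_disjoint) auto
  also have "card ({x \<in> {- int n..int n}. W x = W i \<and> x < i} \<union> {i}) = rank n W i + 1"
    unfolding rank_def by (subst card_Un_disjoint) auto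
  finally show ?thesis using 1 by simp
qed

section \<open>Monotonicity of labels and cells of an involution\<close>

lemma odd_ext_uminus [simp]: "odd_ext s (- i) = - odd_ext s i"
  by (simp add: odd_ext_def)

lemma odd_ext_zero [simp]: "odd_ext s 0 = 0"
  by (simp add: odd_ext_def)

lemma odd_ext_of_nat: "s 0 = 0 \<Longrightarrow> odd_ext s (int i) = s i"
  by (cases "i = 0") (auto simp: odd_ext_def)

lemma involutions_B_apply:
  assumes "\<pi> \<in> involutions_B n"
  shows "\<pi> (- i) = - \<pi> i" "\<pi> (\<pi> i) = i" "\<pi> i = \<pi> j \<longleftrightarrow> i = j" "\<pi> 0 = 0"
    and "i \<in> {- int n..int n} \<Longrightarrow> \<pi> i \<in> {- int n..int n}"
    and "i \<notin> {- int n..int n} \<Longrightarrow> \<pi> i = i"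
proof -
  have bij: "bij_betw (\<lambda>i. \<bar>\<pi> i\<bar>) {1..int n} {1..int n}"
    and odd: "\<And>i. \<pi> (- i) = - \<pi> i" and out: "\<And>i. i > int n \<Longrightarrow> \<pi> i = i" and "\<pi> \<circ> \<pi> = id"
    using assms by (auto simp: involutions_B_def signed_perms_def)
  then show inv: "\<pi> (\<pi> i) = i" for i by (metis comp_apply id_apply)
  show "\<pi> i = \<pi> j \<longleftrightarrow> i = j" by (metis inv)
  show odd: "\<pi> (- i) = - \<pi> i" for i by (rule odd)
  show zero: "\<pi> 0 = 0" using odd[of 0] by simp
  have pos: "\<bar>\<pi> i\<bar> \<in> {1..int n}" if "i \<in> {1..int n}" for i
    using bij that by (auto simp: bij_betw_def)
  show "\<pi> i \<in> {- int n..int n}" if "i \<in> {- int n..int n}"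
  proof -
    have "i = 0 \<or> i \<in> {1..int n} \<or> - i \<in> {1..int n}" using that by auto
    then consider "i = 0" | "i \<in> {1..int n}" | "- i \<in> {1..int n}" by blast
    then show ?thesis
      using pos[of i] pos[of "- i"] zero odd[of i] by cases (auto simp: abs_le_iff)
  qed
  show "\<pi> i = i" if "i \<notin> {- int n..int n}"
  proof (cases "i > int n")
    case False
    then have "- i > int n" using that by auto
    then show ?thesis using out[of "- i"] odd[of i] by simp
  qed (rule out)
qed

text \<open>A label can stay constant only at an ascent of \<open>\<pi>\<close>, and there the
  second component increases. For a negative position, oddness turns the step from i to i + 1 into
  the step from -i - 1 to -i.\<close>

lemma labellings_strict_mono:
  assumes \<pi>: "\<pi> \<in> involutions_B n" and s: "s \<in> labellings n (descent_at \<pi>) m"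
    and "- int n \<le> i" "i < j" "j \<le> int n"
  shows "(odd_ext s i, \<pi> i) < (odd_ext s j, \<pi> j)"
proof (rule strict_step_less[of "- int n" "int n" "\<lambda>i. (odd_ext s i, \<pi> i)"])
  note \<pi>_simps = involutions_B_apply[OF \<pi>]
  have s0: "s 0 = 0" and le: "\<And>i. i < n \<Longrightarrow> s i \<le> s (Suc i)"
    and less: "\<And>i. i < n \<Longrightarrow> \<pi> (int i) > \<pi> (int i + 1) \<Longrightarrow> s i < s (Suc i)"
    using s by (auto simp: labellings_def descent_at_def)
  have step: "odd_ext s i < odd_ext s (i + 1) \<or> odd_ext s i = odd_ext s (i + 1) \<and> \<pi> i < \<pi> (i + 1)"
    if "0 \<le> i" "i < int n" for i
  proof -
    obtain k where k: "i = int k" using \<open>0 \<le> i\<close> nonneg_int_cases by blast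
    have "odd_ext s i = s k" "odd_ext s (i + 1) = s (Suc k)"
      using odd_ext_of_nat[of s k, OF s0] odd_ext_of_nat[of s "Suc k", OF s0] by (simp_all add: k add.commute)
    moreover have "\<pi> i \<noteq> \<pi> (i + 1)" by (simp add: \<pi>_simps)
    ultimately show ?thesis using le[of k] less[of k] that k
      by (metis less_linear nle_le of_nat_less_iff order_le_imp_less_or_eq)
  qed
  fix i assume i: "- int n \<le> i" "i < int n"
  show "(odd_ext s i, \<pi> i) < (odd_ext s (i + 1), \<pi> (i + 1))"
  proof (cases "i \<ge> 0")
    case True
    then show ?thesis using step[of i] i by auto
  next
    case False
    have "- (i + 1) = - i - 1" by simp
    then show ?thesis using step[of "- i - 1"] i False odd_ext_uminus[of s i] odd_ext_uminus[of s "i + 1"]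
        \<pi>_simps(1)[of i] \<pi>_simps(1)[of "i + 1"] by auto
  qed
qed (use assms in auto)

lemma odd_ext_mono:
  assumes "\<pi> \<in> involutions_B n" "s \<in> labellings n (descent_at \<pi>) m"
    and "- int n \<le> i" "i \<le> j" "j \<le> int n"
  shows "odd_ext s i \<le> odd_ext s j"
  using labellings_strict_mono[of \<pi> n s m i j] assms by (cases "i = j") auto

text \<open>If the first coordinates tie, then \<open>\<pi> i < \<pi> j\<close>, and monotonicity of
  the labels orders the second coordinates.\<close>

lemma cell_mono:
  assumes "\<pi> \<in> involutions_B n" "s \<in> labellings n (descent_at \<pi>) m"
    and "- int n \<le> i" "i \<le> j" "j \<le> int n"
  shows "cell \<pi> s i \<le> cell \<pi> s j"
proof (cases "i = j")
  case False
  then have "(odd_ext s i, \<pi> i) < (odd_ext s j, \<pi> j)"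
    using labellings_strict_mono[of \<pi> n s m i j] assms by auto
  moreover have "\<pi> i \<in> {- int n..int n}" "\<pi> j \<in> {- int n..int n}"
    using involutions_B_apply(5)[OF assms(1)] assms by auto
  ultimately show ?thesis
    using odd_ext_mono[OF assms(1,2), of "\<pi> i" "\<pi> j"] by (auto simp: cell_def)
qed simp

lemma cell_uminus: "\<pi> \<in> involutions_B n \<Longrightarrow> cell \<pi> s (- i) = - cell \<pi> s i"
  by (simp add: cell_def involutions_B_apply uminus_prod_def)

lemma cell_swap: "\<pi> \<in> involutions_B n \<Longrightarrow> cell \<pi> s (\<pi> i) = prod.swap (cell \<pi> s i)"
  by (simp add: cell_def involutions_B_apply)

text \<open>Equal cells have equal labels, so \<open>\<pi>\<close> is increasing on every fibre.
  Being its own inverse, it is an order isomorphism between the fibre of a cell and that of the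
  swapped cell, and so keeps ranks.\<close>

lemma rank_cell:
  assumes \<pi>: "\<pi> \<in> involutions_B n" and s: "s \<in> labellings n (descent_at \<pi>) m"
    and i: "i \<in> {- int n..int n}"
  shows "rank n (cell \<pi> s) (\<pi> i) = rank n (cell \<pi> s) i"
proof -
  note \<pi>_simps = involutions_B_apply[OF \<pi>]
  have less: "\<pi> x < \<pi> y" if "x \<in> {- int n..int n}" "y \<in> {- int n..int n}"
    "cell \<pi> s x = cell \<pi> s y" "x < y" for x y
    using labellings_strict_mono[OF \<pi> s, of x y] that by (auto simp: cell_def)
  have "bij_betw \<pi> {x \<in> {- int n..int n}. cell \<pi> s x = cell \<pi> s i \<and> x < i}
     {x \<in> {- int n..int n}. cell \<pi> s x = cell \<pi> s (\<pi> i) \<and> x < \<pi> i}"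
  proof (rule bij_betw_byWitness[where f' = \<pi>])
    show "\<pi> ` {x \<in> {- int n..int n}. cell \<pi> s x = cell \<pi> s i \<and> x < i}
      \<subseteq> {x \<in> {- int n..int n}. cell \<pi> s x = cell \<pi> s (\<pi> i) \<and> x < \<pi> i}"
    proof safe
      fix x assume x: "x \<in> {- int n..int n}" "cell \<pi> s x = cell \<pi> s i" "x < i"
      show "\<pi> x \<in> {- int n..int n}" using \<pi>_simps(5) x by simp
      show "cell \<pi> s (\<pi> x) = cell \<pi> s (\<pi> i)" using cell_swap[OF \<pi>] x by simp
      show "\<pi> x < \<pi> i" using less x i by simp
    qed
    show "\<pi> ` {x \<in> {- int n..int n}. cell \<pi> s x = cell \<pi> s (\<pi> i) \<and> x < \<pi> i}
      \<subseteq> {x \<in> {- int n..int n}. cell \<pi> s x = cell \<pi> s i \<and> x < i}"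
    proof safe
      fix x assume x: "x \<in> {- int n..int n}" "cell \<pi> s x = cell \<pi> s (\<pi> i)" "x < \<pi> i"
      show "\<pi> x \<in> {- int n..int n}" using \<pi>_simps(5) x by simp
      show "cell \<pi> s (\<pi> x) = cell \<pi> s i" using cell_swap[OF \<pi>] x by simp
      show "\<pi> x < i" using less[of x "\<pi> i"] x i \<pi>_simps(5)[of i] by (simp add: \<pi>_simps(2))
    qed
  qed (auto simp: \<pi>_simps(2))
  from bij_betw_same_card[OF this] show ?thesis by (simp add: rank_def)
qed

text \<open>\<open>\<pi> i\<close> itself has the swapped cell and the same rank, and a cell
  together with a rank names at most one position.\<close>

lemma involution_eq_of_cell:
  assumes \<pi>: "\<pi> \<in> involutions_B n" and s: "s \<in> labellings n (descent_at \<pi>) m"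
    and "i \<in> {- int n..int n}" "j \<in> {- int n..int n}"
    and "cell \<pi> s j = prod.swap (cell \<pi> s i)" "rank n (cell \<pi> s) j = rank n (cell \<pi> s) i"
  shows "j = \<pi> i"
  using assms rank_cell[OF \<pi> s, of i] cell_swap[OF \<pi>, of s i] involutions_B_apply(5)[OF \<pi>]
  by (intro rank_inj[where n = n and W = "cell \<pi> s"]) auto

section \<open>Multisets of cells and their injectivity\<close>

definition cells :: "nat \<Rightarrow> (int \<times> int) set" where
  "cells m = {c. c \<ge> 0 \<and> fst c \<le> int m \<and> \<bar>snd c\<bar> \<le> int m}"

text \<open>Only positive positions contribute to a cell multiset, and their cells are
  lexicographically nonnegative. A swapped cell may be negative and then is represented by its
  opposite. The sum over \<open>c\<close> and \<open>- c\<close> is the multiplicity in the multiset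
  completed by negation, and that is what swapping preserves.\<close>

definition swap_symmetric :: "(int \<times> int) multiset \<Rightarrow> bool" where
  "swap_symmetric M \<longleftrightarrow> (\<forall>c. count M c + count M (- c) =
     count M (prod.swap c) + count M (- prod.swap c))"

definition cell_mset :: "nat \<Rightarrow> (int \<Rightarrow> int) \<Rightarrow> (nat \<Rightarrow> int) \<Rightarrow> (int \<times> int) multiset" where
  "cell_mset n \<pi> s = mset (map (\<lambda>i. cell \<pi> s (int i)) [1..<Suc n])"

definition labelled_involutions :: "nat \<Rightarrow> nat \<Rightarrow> ((int \<Rightarrow> int) \<times> (nat \<Rightarrow> int)) set" where
  "labelled_involutions n m = (SIGMA \<pi>:involutions_B n. labellings n (descent_at \<pi>) m)"

text \<open>
  The involution maps each fibre of \<open>W\<close> increasingly onto the fibre of the swapped cell, so it is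
  recovered by matching ranks within fibres.
\<close>

definition involution_of :: "nat \<Rightarrow> (int \<Rightarrow> int \<times> int) \<Rightarrow> int \<Rightarrow> int" where
  "involution_of n W i = (if i \<in> {- int n..int n}
     then THE j. j \<in> {- int n..int n} \<and> W j = prod.swap (W i) \<and> rank n W j = rank n W i
     else i)"

lemma size_cell_mset [simp]: "size (cell_mset n \<pi> s) = n"
  by (simp add: cell_mset_def)

text \<open>Cells increase with the position, so sorting the multiset gives back the cell of each
  position. First coordinates then yield \<open>s\<close>, and matching ranks in fibres yields
  \<open>\<pi>\<close>.\<close>

lemma inj_on_cell_mset: "inj_on (\<lambda>(\<pi>, s). cell_mset n \<pi> s) (labelled_involutions n m)"
proof (rule inj_onI, clarify)
  fix \<pi> s \<pi>' s'
  assume "(\<pi>, s) \<in> labelled_involutions n m" "(\<pi>', s') \<in> labelled_involutions n m"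
  then have \<pi>: "\<pi> \<in> involutions_B n" and s: "s \<in> labellings n (descent_at \<pi>) m"
    and \<pi>': "\<pi>' \<in> involutions_B n" and s': "s' \<in> labellings n (descent_at \<pi>') m"
    by (auto simp: labelled_involutions_def)
  assume "cell_mset n \<pi> s = cell_mset n \<pi>' s'"
  then have ms: "mset (map (\<lambda>i. cell \<pi> s (int i)) [1..<Suc n]) =
      mset (map (\<lambda>i. cell \<pi>' s' (int i)) [1..<Suc n])" by (simp add: cell_mset_def)
  have sorted: "sorted (map (\<lambda>i. cell \<pi> s (int i)) [1..<Suc n])"
    if "\<pi> \<in> involutions_B n" "s \<in> labellings n (descent_at \<pi>) m" for \<pi> s
    using cell_mono[OF that] unfolding sorted_map
    by (intro sorted_wrt_mono_rel[OF _ sorted_upt[of 1 "Suc n"]]) auto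
  have "map (\<lambda>i. cell \<pi> s (int i)) [1..<Suc n] = map (\<lambda>i. cell \<pi>' s' (int i)) [1..<Suc n]"
    using properties_for_sort[OF ms sorted[OF \<pi> s]] sorted[OF \<pi>' s'] by (simp add: sorted_sort_id)
  then have eq_pos: "cell \<pi> s (int i) = cell \<pi>' s' (int i)" if "1 \<le> i" "i \<le> n" for i
    using that by (auto simp: map_eq_conv simp del: upt_Suc)
  have eq: "cell \<pi> s i = cell \<pi>' s' i" if "i \<in> {- int n..int n}" for i
  proof -
    have "i = 0 \<or> 1 \<le> nat i \<and> nat i \<le> n \<and> i = int (nat i) \<or> 1 \<le> nat (- i) \<and> nat (- i) \<le> n \<and> - i = int (nat (- i))"
      using that by auto
    then consider "i = 0" | "1 \<le> nat i" "nat i \<le> n" "i = int (nat i)"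
      | "1 \<le> nat (- i)" "nat (- i) \<le> n" "- i = int (nat (- i))" by blast
    then show ?thesis
    proof cases
      case 1
      then show ?thesis by (simp add: cell_def involutions_B_apply(4)[OF \<pi>] involutions_B_apply(4)[OF \<pi>'])
    next
      case 2
      then show ?thesis using eq_pos[of "nat i"] by metis
    next
      case 3
      then have "- cell \<pi> s (- i) = - cell \<pi>' s' (- i)" using eq_pos[of "nat (- i)"] by metis
      then show ?thesis by (simp add: cell_uminus[OF \<pi>] cell_uminus[OF \<pi>'])
    qed
  qed
  have "s i = s' i" for i
  proof -
    have "s 0 = 0" "s' 0 = 0" "i > n \<Longrightarrow> s i = 0" "i > n \<Longrightarrow> s' i = 0"
      using s s' by (auto simp: labellings_def)
    then show ?thesis using eq_pos[of i] by (cases "1 \<le> i \<and> i \<le> n")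
        (auto simp: cell_def odd_ext_of_nat not_le)
  qed
  then have "s = s'" by blast
  moreover have "\<pi> i = \<pi>' i" for i
  proof (cases "i \<in> {- int n..int n}")
    case True
    have rank_eq: "rank n (cell \<pi> s) j = rank n (cell \<pi>' s') j" if "j \<in> {- int n..int n}" for j
      unfolding rank_def using eq that by (intro arg_cong[where f = card]) auto
    \<comment> \<open>Cells and ranks agree for both pairs, so \<open>\<pi> i\<close> also satisfies
      the description that characterises \<open>\<pi>' i\<close>.\<close>
    have "\<pi> i \<in> {- int n..int n}" using involutions_B_apply(5)[OF \<pi> True] .
    then show ?thesis
      using involution_eq_of_cell[OF \<pi>' s' True, of "\<pi> i"] eq[of "\<pi> i"] eq[OF True]
        cell_swap[OF \<pi>, of s i] rank_cell[OF \<pi> s True] rank_eq[of "\<pi> i"] rank_eq[OF True]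
      by simp
  next
    case False
    then show ?thesis using involutions_B_apply(6)[OF \<pi>] involutions_B_apply(6)[OF \<pi>'] by simp
  qed
  ultimately show "\<pi> = \<pi>' \<and> s = s'" by blast
qed

lemma size_filter_mset_upt:
  assumes "M = mset (map (\<lambda>i. W (int i)) [1..<Suc n])"
  shows "size (filter_mset P M) = card {x \<in> {1..int n}. P (W x)}"
proof -
  have "size (filter_mset P M) = card {i \<in> {1..<Suc n}. P (W (int i))}"
    by (simp add: assms filter_mset_image_mset del: upt_Suc)
  also have "\<dots> = card {x \<in> {1..int n}. P (W x)}"
    by (rule bij_betw_same_card[of int], rule bij_betw_byWitness[where f' = nat]) auto
  finally show ?thesis .
qed

text \<open>The positive positions of the fibre contribute \<open>count M c\<close> and the negative
  ones, by oddness, \<open>count M (- c)\<close>. The extra 1 is position 0, whose cell is the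
  origin.\<close>

lemma card_cell_eq:
  assumes odd: "\<And>x. W (- x) = - W x"
    and pos: "\<And>x. x \<in> {1..int n} \<Longrightarrow> W x \<ge> (0 :: int \<times> int)"
    and M: "M = mset (map (\<lambda>i. W (int i)) [1..<Suc n])"
  shows "card {x \<in> {- int n..int n}. W x = c} = count M c + count M (- c) + (if c = 0 then 1 else 0)"
proof -
  have W0: "W 0 = 0"
    using odd[of 0] by (simp add: prod_eq_iff)
  have count: "count M c = card {x \<in> {1..int n}. W x = c}" for c
    using size_filter_mset_upt[OF M, of "\<lambda>x. x = c"] by (simp add: filter_eq_replicate_mset)
  have neg: "card {x \<in> {- int n..-1}. W x = c} = card {x \<in> {1..int n}. W x = - c}"
    by (rule bij_betw_same_card[of uminus], rule bij_betw_byWitness[where f' = uminus])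
      (auto simp: odd)
  have "card {x \<in> {- int n..int n}. W x = c} =
     card ({x \<in> {- int n..-1}. W x = c} \<union> ({x \<in> {1..int n}. W x = c} \<union> {x. x = 0 \<and> c = 0}))"
  proof (rule arg_cong[where f = card], rule set_eqI)
    fix x
    show "x \<in> {x \<in> {- int n..int n}. W x = c} \<longleftrightarrow>
      x \<in> {x \<in> {- int n..-1}. W x = c} \<union> ({x \<in> {1..int n}. W x = c} \<union> {x. x = 0 \<and> c = 0})"
      using W0 by (cases x "0 :: int" rule: linorder_cases) auto
  qed
  also have "\<dots> = card {x \<in> {- int n..-1}. W x = c} + card ({x \<in> {1..int n}. W x = c} \<union> {x. x = 0 \<and> c = 0})"
    by (rule card_Un_disjoint) (auto intro: finite_subset[of _ "{- int n..int n}"])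
  also have "card ({x \<in> {1..int n}. W x = c} \<union> {x. x = 0 \<and> c = 0}) =
      card {x \<in> {1..int n}. W x = c} + card {x :: int. x = 0 \<and> c = 0}"
    by (rule card_Un_disjoint) (auto intro: finite_subset[of _ "{- int n..int n}"])
  also have "card {x :: int. x = 0 \<and> c = 0} = (if c = 0 then 1 else 0)" by auto
  finally show ?thesis using neg count by simp
qed

lemma cell_mset_in:
  assumes "(\<pi>, s) \<in> labelled_involutions n m"
  shows "set_mset (cell_mset n \<pi> s) \<subseteq> cells m" "swap_symmetric (cell_mset n \<pi> s)"
proof -
  have \<pi>: "\<pi> \<in> involutions_B n" and s: "s \<in> labellings n (descent_at \<pi>) m"
    using assms by (auto simp: labelled_involutions_def)
  note \<pi>_simps = involutions_B_apply[OF \<pi>]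
  have cell0: "cell \<pi> s 0 = 0" by (simp add: cell_def \<pi>_simps zero_prod_def)
  have nonneg: "cell \<pi> s i \<ge> 0" if "i \<in> {1..int n}" for i
    using cell_mono[OF \<pi> s, of 0 i] that cell0 by simp
  have le: "odd_ext s i \<le> int m" if "i \<in> {- int n..int n}" for i
  proof -
    have "odd_ext s i \<le> odd_ext s (int n)" using odd_ext_mono[OF \<pi> s, of i "int n"] that by simp
    also have "\<dots> \<le> int m" using s by (simp add: odd_ext_of_nat labellings_def)
    finally show ?thesis .
  qed
  have abs: "\<bar>odd_ext s i\<bar> \<le> int m" if "i \<in> {- int n..int n}" for i
    using le[of i] le[of "- i"] that by auto
  show "set_mset (cell_mset n \<pi> s) \<subseteq> cells m"
  proof
    fix c assume "c \<in># cell_mset n \<pi> s"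
    then obtain i where i: "1 \<le> i" "i \<le> n" and c: "c = cell \<pi> s (int i)"
      by (auto simp: cell_mset_def simp del: upt_Suc)
    have "\<pi> (int i) \<in> {- int n..int n}" using i by (intro \<pi>_simps(5)) auto
    then show "c \<in> cells m" using nonneg[of "int i"] abs[of "\<pi> (int i)"] le[of "int i"] i
      unfolding c by (auto simp: cells_def cell_def)
  qed
  show "swap_symmetric (cell_mset n \<pi> s)"
    unfolding swap_symmetric_def
  proof
    fix c
    \<comment> \<open>Equal fibre sizes translate into the required identity of counts; the
      contribution of position 0 cancels because swapping fixes the origin and nothing else becomes
      the origin.\<close>
    have "bij_betw \<pi> {x \<in> {- int n..int n}. cell \<pi> s x = c} {x \<in> {- int n..int n}. cell \<pi> s x = prod.swap c}"
      by (rule bij_betw_byWitness[where f' = \<pi>]) (use \<pi>_simps(2,5) cell_swap[OF \<pi>] in auto)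
    from bij_betw_same_card[OF this]
    have "card {x \<in> {- int n..int n}. cell \<pi> s x = c} = card {x \<in> {- int n..int n}. cell \<pi> s x = prod.swap c}" .
    moreover have "prod.swap c = 0 \<longleftrightarrow> c = 0" by (auto simp: zero_prod_def prod_eq_iff)
    moreover note card_cell_eq[of "cell \<pi> s", OF cell_uminus[OF \<pi>] nonneg cell_mset_def[of n \<pi> s], of c]
      card_cell_eq[of "cell \<pi> s", OF cell_uminus[OF \<pi>] nonneg cell_mset_def[of n \<pi> s], of "prod.swap c"]
    ultimately show "count (cell_mset n \<pi> s) c + count (cell_mset n \<pi> s) (- c) =
       count (cell_mset n \<pi> s) (prod.swap c) + count (cell_mset n \<pi> s) (- prod.swap c)"
      by simp
  qed
qed

section \<open>Reconstruction of an involution from a symmetric multiset\<close>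

lemma involution_of_props:
  assumes sym: "\<And>c. card {x \<in> {- int n..int n}. W x = c} = card {x \<in> {- int n..int n}. W x = prod.swap c}"
    and i: "i \<in> {- int n..int n}"
  shows "involution_of n W i \<in> {- int n..int n}"
    and "W (involution_of n W i) = prod.swap (W i)"
    and "rank n W (involution_of n W i) = rank n W i"
    and "j \<in> {- int n..int n} \<Longrightarrow> W j = prod.swap (W i) \<Longrightarrow> rank n W j = rank n W i \<Longrightarrow> involution_of n W i = j"
proof -
  have uniq: "j = k" if "j \<in> {- int n..int n}" "W j = prod.swap (W i)" "rank n W j = rank n W i"
    "k \<in> {- int n..int n}" "W k = prod.swap (W i)" "rank n W k = rank n W i" for j k
    using that by (intro rank_inj[of j n k W]) auto
  \<comment> \<open>The ranks in a fibre are exactly the numbers below its size. Fibres of swapped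
    cells have equal size, so the rank of \<open>i\<close> also occurs in the fibre of
    \<open>prod.swap (W i)\<close>.\<close>
  have "rank n W i \<in> {..<card {x \<in> {- int n..int n}. W x = W i}}"
    using bij_betwE[OF rank_bij_betw[of n W "W i"]] i by blast
  also have "{..<card {x \<in> {- int n..int n}. W x = W i}} = rank n W ` {x \<in> {- int n..int n}. W x = prod.swap (W i)}"
    using bij_betw_imp_surj_on[OF rank_bij_betw[of n W "prod.swap (W i)"]] sym[of "W i"] by simp
  finally have "\<exists>j. j \<in> {- int n..int n} \<and> W j = prod.swap (W i) \<and> rank n W j = rank n W i"
    by (elim imageE) auto
  then have "\<exists>!j. j \<in> {- int n..int n} \<and> W j = prod.swap (W i) \<and> rank n W j = rank n W i"
    using uniq by blast
  from theI'[OF this] have *: "involution_of n W i \<in> {- int n..int n} \<and> W (involution_of n W i) = prod.swap (W i)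
     \<and> rank n W (involution_of n W i) = rank n W i"
    using i by (simp add: involution_of_def)
  then show "involution_of n W i \<in> {- int n..int n}" "W (involution_of n W i) = prod.swap (W i)"
    "rank n W (involution_of n W i) = rank n W i" by auto
  show "involution_of n W i = j"
    if "j \<in> {- int n..int n}" "W j = prod.swap (W i)" "rank n W j = rank n W i"
    using * that uniq by blast
qed

text \<open>Swapping twice is the identity, which makes the map an involution. For oddness, the
  ranks of i and -i add up to the fibre size minus one; since \<open>i\<close> and its image have
  equal ranks and fibres of equal size, so do their negatives.\<close>

lemma involution_of_in_involutions_B:
  assumes odd: "\<And>x. W (- x) = - W x"
    and sym: "\<And>c. card {x \<in> {- int n..int n}. W x = c} = card {x \<in> {- int n..int n}. W x = prod.swap c}"
  shows "involution_of n W \<in> involutions_B n"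
proof -
  let ?\<pi> = "involution_of n W"
  note props = involution_of_props[OF sym]
  have out: "?\<pi> i = i" if "i \<notin> {- int n..int n}" for i
    using that by (auto simp: involution_of_def)
  have invol: "?\<pi> (?\<pi> i) = i" for i
  proof (cases "i \<in> {- int n..int n}")
    case True
    then show ?thesis using props(1-3)[of i] by (intro props(4)) auto
  qed (simp add: out)
  have uminus: "?\<pi> (- i) = - ?\<pi> i" for i
  proof (cases "i \<in> {- int n..int n}")
    case True
    have "rank n W (- ?\<pi> i) + rank n W (?\<pi> i) + 1 = card {x \<in> {- int n..int n}. W x = prod.swap (W i)}"
      using rank_uminus[where W = W, OF odd props(1)[OF True]] props(2)[OF True] by simp
    moreover have "rank n W (- i) + rank n W i + 1 = card {x \<in> {- int n..int n}. W x = W i}"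
      using rank_uminus[where W = W, OF odd True] .
    ultimately have "rank n W (- ?\<pi> i) = rank n W (- i)"
      using props(3)[OF True] sym[of "W i"] by linarith
    then show ?thesis using True props(1,2)[OF True] by (intro props(4)) (auto simp: odd prod_eq_iff)
  qed (auto simp: out)
  have inj: "?\<pi> i = ?\<pi> j \<longleftrightarrow> i = j" for i j using invol by metis
  have zero: "?\<pi> 0 = 0" using uminus[of 0] by simp
  have "inj_on (\<lambda>i. \<bar>?\<pi> i\<bar>) {1..int n}"
  proof (rule inj_onI)
    fix i j assume ij: "i \<in> {1..int n}" "j \<in> {1..int n}" "\<bar>?\<pi> i\<bar> = \<bar>?\<pi> j\<bar>"
    then have "?\<pi> i = ?\<pi> j \<or> ?\<pi> i = ?\<pi> (- j)" by (auto simp: uminus abs_eq_iff)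
    then show "i = j" using ij by (auto simp: inj)
  qed
  moreover have "(\<lambda>i. \<bar>?\<pi> i\<bar>) ` {1..int n} \<subseteq> {1..int n}"
  proof clarify
    fix i assume i: "i \<in> {1..int n}"
    then have "?\<pi> i \<noteq> ?\<pi> 0" unfolding inj by auto
    then show "\<bar>?\<pi> i\<bar> \<in> {1..int n}" using props(1)[of i] i zero by auto
  qed
  ultimately have "bij_betw (\<lambda>i. \<bar>?\<pi> i\<bar>) {1..int n} {1..int n}"
    by (intro bij_betw_imageI endo_inj_surj) auto
  then show ?thesis
    using uminus out invol by (auto simp: involutions_B_def signed_perms_def fun_eq_iff)
qed

lemma uminus_le_uminus_iff: "- c \<le> - d \<longleftrightarrow> d \<le> (c :: int \<times> int)"
  by (auto simp: less_eq_prod_def)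

text \<open>Sorting the multiset assigns its cells to the positions 1..n; the labels are the first
  coordinates, and \<open>involution_of\<close> supplies the involution. The point to check is that
  labels rise strictly at its descents.\<close>

lemma cell_mset_surj:
  assumes cells: "set_mset M \<subseteq> cells m" and sym: "swap_symmetric M" and size: "size M = n"
  shows "\<exists>(\<pi>, s) \<in> labelled_involutions n m. cell_mset n \<pi> s = M"
proof -
  define w where "w = sorted_list_of_multiset M"
  have sorted: "sorted w" and mset: "mset w = M" and len: "length w = n"
    using size by (simp_all add: w_def sorted_sorted_list_of_multiset) (metis mset_sorted_list_of_multiset size_mset)
  \<comment> \<open>Position i carries the i-th smallest cell, at index i - 1 of the list; the rest
    is the odd extension.\<close>
  define W where "W i = (if i \<in> {1..int n} then w ! (nat i - 1)
     else if - i \<in> {1..int n} then - (w ! (nat (- i) - 1)) else 0)" for i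
  have odd: "W (- x) = - W x" for x
    by (auto simp: W_def)
  have W_in: "W i \<in> cells m" if "i \<in> {1..int n}" for i
    using that cells len unfolding mset[symmetric] by (auto simp: W_def)
  have W_pos: "W i \<ge> 0" if "i \<in> {1..int n}" for i
    using W_in[OF that] by (simp add: cells_def)
  have "map (\<lambda>i. W (int i)) [1..<Suc n] = w"
    by (rule nth_equalityI) (auto simp: W_def len nat_add_distrib simp del: upt_Suc)
  then have M: "M = mset (map (\<lambda>i. W (int i)) [1..<Suc n])" by (simp add: mset)
  have card_sym: "card {x \<in> {- int n..int n}. W x = c} = card {x \<in> {- int n..int n}. W x = prod.swap c}" for c
  proof -
    have "prod.swap c = 0 \<longleftrightarrow> c = 0" by (auto simp: zero_prod_def prod_eq_iff)
    then show ?thesis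
      using sym card_cell_eq[of W, OF odd W_pos M, of c] card_cell_eq[of W, OF odd W_pos M, of "prod.swap c"]
      by (simp add: swap_symmetric_def del: split_paired_All)
  qed
  have mono_nonneg: "W i \<le> W j" if "0 \<le> i" "i \<le> j" "j \<le> int n" for i j
  proof (cases "i = 0")
    case True
    then show ?thesis using W_pos[of j] that odd[of 0] by (cases "j = 0") (auto simp: prod_eq_iff W_def)
  next
    case False
    then show ?thesis using that len sorted_nth_mono[OF sorted, of "nat i - 1" "nat j - 1"]
      by (auto simp: W_def)
  qed
  have mono: "W i \<le> W j" if "- int n \<le> i" "i \<le> j" "j \<le> int n" for i j
  proof -
    consider "0 \<le> i" | "j \<le> 0" | "i \<le> 0" "0 \<le> j" by linarith
    then show ?thesis
    proof cases
      case 2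
      then have "W (- j) \<le> W (- i)" using that by (intro mono_nonneg) auto
      then show ?thesis by (simp add: odd uminus_le_uminus_iff)
    next
      case 3
      have "W 0 \<le> W (- i)" "W 0 \<le> W j" using that 3 by (auto intro!: mono_nonneg)
      moreover have "- W 0 = W 0" using odd[of 0] by simp
      ultimately show ?thesis using odd[of i] uminus_le_uminus_iff[of "W 0" "W i"]
        by (metis order_trans)
    qed (use that mono_nonneg in auto)
  qed
  let ?\<pi> = "involution_of n W"
  note props = involution_of_props[OF card_sym]
  have \<pi>: "?\<pi> \<in> involutions_B n"
    by (rule involution_of_in_involutions_B[OF odd card_sym])
  define s where "s i = fst (W (int i))" for i
  have s0: "s 0 = 0" by (simp add: s_def W_def)
  have ext: "odd_ext s i = fst (W i)" for i
  proof (cases "i \<ge> 0")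
    case True
    then show ?thesis using odd_ext_of_nat[of s "nat i"] s0 by (simp add: s_def)
  next
    case False
    then have "odd_ext s (- i) = fst (W (- i))" using odd_ext_of_nat[of s "nat (- i)"] s0 by (simp add: s_def)
    then show ?thesis by (simp add: odd)
  qed
  have cell: "cell ?\<pi> s i = W i" if "i \<in> {- int n..int n}" for i
    using props(2)[OF that] by (simp add: cell_def ext prod_eq_iff)
  have "s i \<le> s (Suc i)" if "i < n" for i
    using mono[of "int i" "int (Suc i)"] that by (auto simp: s_def less_eq_prod_def)
  moreover have "s i < s (Suc i)" if "i < n" "descent_at ?\<pi> i" for i
  proof (rule ccontr)
    assume "\<not> s i < s (Suc i)"
    have i: "int i \<in> {- int n..int n}" "int i + 1 \<in> {- int n..int n}" using \<open>i < n\<close> by auto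
    have le: "W (int i) \<le> W (int i + 1)" using mono[of "int i" "int i + 1"] i by auto
    have desc: "?\<pi> (int i + 1) < ?\<pi> (int i)" using \<open>descent_at ?\<pi> i\<close> by (simp add: descent_at_def)
    have fst_eq: "fst (W (int i)) = fst (W (int i + 1))"
      using le \<open>\<not> s i < s (Suc i)\<close> by (auto simp: s_def less_eq_prod_def add.commute)
    \<comment> \<open>The descent orders the image cells the other way round. As first coordinates
      of the images are second coordinates of the cells at i and i + 1, and the labels tie, the two
      cells coincide.\<close>
    have "W (?\<pi> (int i + 1)) \<le> W (?\<pi> (int i))"
      using desc props(1)[OF i(1)] props(1)[OF i(2)] by (intro mono) auto
    then have eq: "W (int i) = W (int i + 1)"
      using fst_eq le unfolding props(2)[OF i(1)] props(2)[OF i(2)]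
      by (auto simp: less_eq_prod_def prod_eq_iff)
    \<comment> \<open>Inside one fibre the rank rises from i to i + 1, while the descent makes the
      rank of the images fall; yet passing to images preserves ranks.\<close>
    have "rank n W (int i) < rank n W (int i + 1)" using eq i by (intro rank_less) auto
    moreover have "rank n W (?\<pi> (int i + 1)) < rank n W (?\<pi> (int i))"
      using desc eq props(1)[OF i(2)] props(2)[OF i(1)] props(2)[OF i(2)] by (intro rank_less) auto
    ultimately show False using props(3)[OF i(1)] props(3)[OF i(2)] by simp
  qed
  moreover have "s n \<le> int m"
    using W_in[of "int n"] s0 by (cases "n = 0") (auto simp: s_def cells_def)
  moreover have "s i = 0" if "i > n" for i using that by (simp add: s_def W_def)
  ultimately have "s \<in> labellings n (descent_at ?\<pi>) m"
    using s0 by (auto simp: labellings_def)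
  then have "(?\<pi>, s) \<in> labelled_involutions n m" using \<pi> by (simp add: labelled_involutions_def)
  moreover have "cell_mset n ?\<pi> s = M"
    unfolding cell_mset_def M using cell by (intro arg_cong[where f = mset] map_cong) auto
  ultimately show ?thesis by blast
qed

section \<open>Splitting off the fixed points\<close>

text \<open>The origin is excluded here, since it is treated as a diagonal cell: its fibre is
  matched increasingly with itself, so its positions are genuinely fixed.\<close>

definition antidiagonal :: "(int \<times> int) \<Rightarrow> bool" where
  "antidiagonal c \<longleftrightarrow> fst c = - snd c \<and> fst c \<noteq> snd c"

definition fixed_part :: "(int \<times> int) multiset \<Rightarrow> (int \<times> int) multiset" where
  "fixed_part M = filter_mset (\<lambda>c. fst c = snd c) M +
     mset_set {c \<in> set_mset M. antidiagonal c \<and> odd (count M c)}"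

lemma odd_count_in: "odd (count M c) \<Longrightarrow> c \<in># M"
  by (metis even_zero not_in_iff)

text \<open>A diagonal fibre is matched increasingly with itself, so \<open>\<pi>\<close> is the
  identity on it. An antidiagonal fibre is matched with its negative; there
  \<open>\<pi> i = - i\<close> means that i and -i have equal ranks, which singles out the middle
  element and requires an odd fibre size.\<close>

lemma fix_B_eq:
  assumes "(\<pi>, s) \<in> labelled_involutions n m"
  shows "fix_B n \<pi> = size (fixed_part (cell_mset n \<pi> s))"
proof -
  have \<pi>: "\<pi> \<in> involutions_B n" and s: "s \<in> labellings n (descent_at \<pi>) m"
    using assms by (auto simp: labelled_involutions_def)
  note \<pi>_simps = involutions_B_apply[OF \<pi>]
  let ?W = "cell \<pi> s" and ?M = "cell_mset n \<pi> s"
  have cell0: "?W 0 = 0" by (simp add: cell_def \<pi>_simps zero_prod_def)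
  have nonneg: "?W i \<ge> 0" if "i \<in> {1..int n}" for i
    using cell_mono[OF \<pi> s, of 0 i] that cell0 by simp
  note size_filter = size_filter_mset_upt[OF cell_mset_def[of n \<pi> s]]
  have fixed: "\<pi> i = i \<longleftrightarrow> fst (?W i) = snd (?W i)" if "i \<in> {1..int n}" for i
  proof
    assume "fst (?W i) = snd (?W i)"
    then have "i = \<pi> i" using that
      by (intro involution_eq_of_cell[OF \<pi> s]) (auto simp: prod_eq_iff)
    then show "\<pi> i = i" by simp
  qed (auto simp: cell_def)
  have neg: "\<pi> i = - i \<longleftrightarrow> antidiagonal (?W i) \<and> count ?M (?W i) = 2 * rank n ?W i + 1"
    if i: "i \<in> {1..int n}" for i
  proof -
    have "\<pi> i = - i \<longleftrightarrow> ?W (- i) = prod.swap (?W i) \<and> rank n ?W (- i) = rank n ?W i"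
      using involution_eq_of_cell[OF \<pi> s, of i "- i"] cell_swap[OF \<pi>, of s i]
        rank_cell[OF \<pi> s, of i] i by auto
    also have "?W (- i) = prod.swap (?W i) \<longleftrightarrow> fst (?W i) = - snd (?W i)"
      by (auto simp: cell_uminus[OF \<pi>] prod_eq_iff)
    finally have 1: "\<pi> i = - i \<longleftrightarrow> fst (?W i) = - snd (?W i) \<and> rank n ?W (- i) = rank n ?W i" .
    have "\<pi> i \<noteq> - i" if "fst (?W i) = snd (?W i)" using fixed[OF i] that i by auto
    with 1 have 2: "\<pi> i = - i \<longleftrightarrow> antidiagonal (?W i) \<and> rank n ?W (- i) = rank n ?W i"
      by (auto simp: antidiagonal_def)
    have "rank n ?W (- i) = rank n ?W i \<longleftrightarrow> count ?M (?W i) = 2 * rank n ?W i + 1"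
      if "antidiagonal (?W i)"
    proof -
      have ne: "?W i \<noteq> 0" using that by (auto simp: antidiagonal_def)
      \<comment> \<open>The opposite of a nonzero cell of a positive position is lexicographically
        negative, so it does not occur in the multiset, and the fibre size is a single
        count.\<close>
      have "\<not> - ?W i \<ge> 0" using nonneg[OF i] ne by (auto simp: less_eq_prod_def prod_eq_iff)
      then have "count ?M (- ?W i) = 0"
        using cell_mset_in(1)[OF assms] by (auto simp: cells_def count_eq_zero_iff)
      then have "card {x \<in> {- int n..int n}. ?W x = ?W i} = count ?M (?W i)"
        using card_cell_eq[of ?W, OF cell_uminus[OF \<pi>] nonneg cell_mset_def[of n \<pi> s], of "?W i"] ne by simp
      then show ?thesis using rank_uminus[of ?W i n] cell_uminus[OF \<pi>] i by auto
    qed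
    then show ?thesis using 2 by blast
  qed
  have card_neg: "card {i \<in> {1..int n}. \<pi> i = - i} = card {c \<in> set_mset ?M. antidiagonal c \<and> odd (count ?M c)}"
  proof (rule bij_betw_same_card[of ?W], rule bij_betw_imageI)
    show "inj_on ?W {i \<in> {1..int n}. \<pi> i = - i}"
    proof (rule inj_onI)
      fix i j assume "i \<in> {i \<in> {1..int n}. \<pi> i = - i}" "j \<in> {i \<in> {1..int n}. \<pi> i = - i}" "?W i = ?W j"
      then show "i = j" using neg[of i] neg[of j] by (intro rank_inj[of i n j ?W]) auto
    qed
    show "?W ` {i \<in> {1..int n}. \<pi> i = - i} = {c \<in> set_mset ?M. antidiagonal c \<and> odd (count ?M c)}"
    proof (intro equalityI subsetI)
      fix c assume "c \<in> ?W ` {i \<in> {1..int n}. \<pi> i = - i}"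
      then obtain i where i: "i \<in> {1..int n}" "\<pi> i = - i" and c: "c = ?W i" by blast
      from i have *: "antidiagonal (?W i)" "count ?M (?W i) = 2 * rank n ?W i + 1" using neg by blast+
      then have "odd (count ?M (?W i))" by simp
      with * show "c \<in> {c \<in> set_mset ?M. antidiagonal c \<and> odd (count ?M c)}"
        unfolding c using odd_count_in[of ?M] by blast
    next
      fix c assume "c \<in> {c \<in> set_mset ?M. antidiagonal c \<and> odd (count ?M c)}"
      then obtain a b where c_eq: "c = (a, b)" and c: "(a, b) \<in># ?M" "antidiagonal (a, b)" "odd (count ?M (a, b))"
        by (cases c) auto
      \<comment> \<open>\<open>r\<close> is the middle rank of the fibre of size 2 r + 1; the
        position of that rank is the one that \<open>\<pi>\<close> negates.\<close>
      then obtain r where r: "count ?M (a, b) = 2 * r + 1" by (elim oddE)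
      have "\<not> - (a, b) \<ge> 0" "(a, b) \<noteq> 0"
        using c cell_mset_in(1)[OF assms] by (auto simp: cells_def antidiagonal_def zero_prod_def)
      then have "count ?M (- (a, b)) = 0" "(a, b) \<noteq> 0"
        using cell_mset_in(1)[OF assms] by (auto simp: cells_def count_eq_zero_iff)
      then have card: "card {x \<in> {- int n..int n}. ?W x = (a, b)} = count ?M (a, b)"
        using card_cell_eq[of ?W, OF cell_uminus[OF \<pi>] nonneg cell_mset_def[of n \<pi> s], of "(a, b)"] by simp
      have "r \<in> rank n ?W ` {x \<in> {- int n..int n}. ?W x = (a, b)}"
        unfolding bij_betw_imp_surj_on[OF rank_bij_betw] card using r by simp
      then obtain x where x: "x \<in> {- int n..int n}" "?W x = (a, b)" "rank n ?W x = r" by blast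
      have "x \<in> {1..int n}"
      proof (rule ccontr)
        assume "x \<notin> {1..int n}"
        then have "x = 0 \<or> - x \<in> {1..int n}" using x(1) by auto
        then show False
          using nonneg[of "- x"] x(2) cell0 cell_uminus[OF \<pi>, of s x] \<open>\<not> - (a, b) \<ge> 0\<close> \<open>(a, b) \<noteq> 0\<close> by auto
      qed
      moreover from this have "\<pi> x = - x" using neg[of x] x c r by auto
      ultimately show "c \<in> ?W ` {i \<in> {1..int n}. \<pi> i = - i}" using x(2) c_eq by (intro image_eqI[of _ _ x]) auto
    qed
  qed
  have "{i \<in> {1..int n}. \<bar>\<pi> i\<bar> = i} = {i \<in> {1..int n}. \<pi> i = i} \<union> {i \<in> {1..int n}. \<pi> i = - i}"
    by auto
  then have "fix_B n \<pi> = card {i \<in> {1..int n}. \<pi> i = i} + card {i \<in> {1..int n}. \<pi> i = - i}"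
    unfolding fix_B_def by (simp only:, intro card_Un_disjoint) (auto intro: finite_subset[of _ "{1..int n}"])
  also have "card {i \<in> {1..int n}. \<pi> i = i} = size (filter_mset (\<lambda>c. fst c = snd c) ?M)"
    unfolding size_filter using fixed by (intro arg_cong[where f = card]) auto
  also note card_neg
  finally show ?thesis by (simp add: fixed_part_def)
qed

definition symmetric_msets :: "nat \<Rightarrow> nat \<Rightarrow> nat \<Rightarrow> (int \<times> int) multiset set" where
  "symmetric_msets n f m =
     {M. set_mset M \<subseteq> cells m \<and> swap_symmetric M \<and> size M = n \<and> size (fixed_part M) = f}"

lemma card_labelled_involutions:
  "card {(\<pi>, s) \<in> labelled_involutions n m. fix_B n \<pi> = f} = card (symmetric_msets n f m)"
proof (rule bij_betw_same_card[of "\<lambda>(\<pi>, s). cell_mset n \<pi> s"], rule bij_betw_imageI)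
  show "inj_on (\<lambda>(\<pi>, s). cell_mset n \<pi> s) {(\<pi>, s) \<in> labelled_involutions n m. fix_B n \<pi> = f}"
    by (rule inj_on_subset[OF inj_on_cell_mset]) auto
  show "(\<lambda>(\<pi>, s). cell_mset n \<pi> s) ` {(\<pi>, s) \<in> labelled_involutions n m. fix_B n \<pi> = f} = symmetric_msets n f m"
  proof (intro equalityI subsetI)
    fix M assume M: "M \<in> symmetric_msets n f m"
    then obtain \<pi> s where "(\<pi>, s) \<in> labelled_involutions n m" "cell_mset n \<pi> s = M"
      using cell_mset_surj[of M m n] by (auto simp: symmetric_msets_def)
    then show "M \<in> (\<lambda>(\<pi>, s). cell_mset n \<pi> s) ` {(\<pi>, s) \<in> labelled_involutions n m. fix_B n \<pi> = f}"
      using M fix_B_eq by (intro image_eqI[of _ _ "(\<pi>, s)"]) (auto simp: symmetric_msets_def)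
  qed (use cell_mset_in(1)[THEN subsetD] cell_mset_in(2) fix_B_eq in \<open>auto simp: symmetric_msets_def\<close>)
qed

text \<open>The possible values of \<open>fixed_part\<close>: diagonal cells with any multiplicity,
  antidiagonal cells at most once, because only the parity of their multiplicity is
  recorded.\<close>

definition fixed_msets :: "nat \<Rightarrow> nat \<Rightarrow> (int \<times> int) multiset set" where
  "fixed_msets f m = {R. set_mset R \<subseteq> {c \<in> cells m. fst c = snd c} \<union> {c \<in> cells m. antidiagonal c} \<and>
     (\<forall>c \<in> {c \<in> cells m. antidiagonal c}. count R c \<le> 1) \<and> size R = f}"

lemma count_fixed_part: "count (fixed_part M) c =
  (if fst c = snd c then count M c else if antidiagonal c \<and> odd (count M c) then 1 else 0)"
  by (auto simp: fixed_part_def antidiagonal_def count_mset_set' dest: odd_count_in)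

lemma fixed_part_subset: "fixed_part M \<subseteq># M"
  by (auto simp: subseteq_mset_def count_fixed_part Suc_le_eq dest: odd_count_in)

text \<open>On the diagonal swapping fixes a cell and on the antidiagonal it negates it, so adding
  such cells never affects \<open>swap_symmetric\<close>. A multiset with empty fixed part has no
  diagonal cells and even antidiagonal multiplicities, so \<open>R\<close> can be read off from
  \<open>M + R\<close>. Hence the two parts vary independently.\<close>

lemma card_symmetric_msets:
  "card (symmetric_msets (n + f) f m) = card (symmetric_msets n 0 m) * card (fixed_msets f m)"
proof -
  have sym_iff: "swap_symmetric (M + R) \<longleftrightarrow> swap_symmetric M" if "R \<in> fixed_msets f m" for M R
  proof -
    have "count R c + count R (- c) = count R (prod.swap c) + count R (- prod.swap c)" for c
    proof -
      have R: "fst c = snd c \<or> antidiagonal c" if "count R c \<noteq> 0" for c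
        using that \<open>R \<in> fixed_msets f m\<close> by (auto simp: fixed_msets_def count_eq_zero_iff)
      consider "fst c = snd c" | "fst c = - snd c" | "fst c \<noteq> snd c" "fst c \<noteq> - snd c" by blast
      then show ?thesis
      proof cases
        case 1
        then have "prod.swap c = c" by (simp add: prod_eq_iff)
        then show ?thesis by simp
      next
        case 2
        then have "prod.swap c = - c" by (simp add: prod_eq_iff)
        then show ?thesis by simp
      next
        case 3
        have "count R d = 0" if "fst d \<noteq> snd d" "fst d \<noteq> - snd d" for d
          using R[of d] that unfolding antidiagonal_def by blast
        from this[of c] this[of "- c"] this[of "prod.swap c"] this[of "- prod.swap c"] 3
        have "count R c = 0" "count R (- c) = 0" "count R (prod.swap c) = 0" "count R (- prod.swap c) = 0"
          by auto
        then show ?thesis by linarith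
      qed
    qed
    note eq = this
    show ?thesis
      unfolding swap_symmetric_def
    proof (rule iff_allI)
      fix c
      show "count (M + R) c + count (M + R) (- c) = count (M + R) (prod.swap c) + count (M + R) (- prod.swap c)
        \<longleftrightarrow> count M c + count M (- c) = count M (prod.swap c) + count M (- prod.swap c)"
        using eq[of c] unfolding count_union by linarith
    qed
  qed
  have fixed_add: "fixed_part (M + R) = R" if M: "M \<in> symmetric_msets n 0 m" and R: "R \<in> fixed_msets f m" for M R
  proof (rule multiset_eqI)
    fix c
    have "fixed_part M = {#}" using M by (simp add: symmetric_msets_def)
    then have "count (fixed_part M) c = 0" by simp
    then have "fst c = snd c \<Longrightarrow> count M c = 0" "antidiagonal c \<Longrightarrow> even (count M c)"
      unfolding count_fixed_part by (auto simp: antidiagonal_def split: if_splits)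
    moreover have "count R c = 0" if "fst c \<noteq> snd c" "\<not> antidiagonal c"
      using that R by (auto simp: fixed_msets_def count_eq_zero_iff)
    moreover have "count R c = (if odd (count R c) then 1 else 0)" if "antidiagonal c"
    proof (cases "c \<in># R")
      case True
      then have "c \<in> {c \<in> cells m. antidiagonal c}"
        using that R by (auto simp: fixed_msets_def antidiagonal_def)
      then have "count R c \<le> 1" using R unfolding fixed_msets_def by blast
      then have "count R c = 0 \<or> count R c = 1" by linarith
      then show ?thesis by auto
    qed (simp add: not_in_iff)
    ultimately show "count (fixed_part (M + R)) c = count R c"
      unfolding count_fixed_part by (cases "fst c = - snd c") (auto simp: antidiagonal_def split: if_splits)
  qed
  have "bij_betw (\<lambda>(M, R). M + R) (symmetric_msets n 0 m \<times> fixed_msets f m) (symmetric_msets (n + f) f m)"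
  proof (rule bij_betw_byWitness[where f' = "\<lambda>M. (M - fixed_part M, fixed_part M)"])
    show "\<forall>a\<in>symmetric_msets n 0 m \<times> fixed_msets f m.
       ((case a of (M, R) \<Rightarrow> M + R) - fixed_part (case a of (M, R) \<Rightarrow> M + R),
        fixed_part (case a of (M, R) \<Rightarrow> M + R)) = a"
      using fixed_add by auto
    show "\<forall>M\<in>symmetric_msets (n + f) f m. (case (M - fixed_part M, fixed_part M) of (M, R) \<Rightarrow> M + R) = M"
      using fixed_part_subset by auto
    show "(\<lambda>(M, R). M + R) ` (symmetric_msets n 0 m \<times> fixed_msets f m) \<subseteq> symmetric_msets (n + f) f m"
      using fixed_add sym_iff by (auto simp: symmetric_msets_def fixed_msets_def)
    show "(\<lambda>M. (M - fixed_part M, fixed_part M)) ` symmetric_msets (n + f) f m \<subseteq> symmetric_msets n 0 m \<times> fixed_msets f m"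
    proof safe
      fix M assume M: "M \<in> symmetric_msets (n + f) f m"
      have sub: "set_mset (fixed_part M) \<subseteq> set_mset M" using fixed_part_subset[of M] by (rule set_mset_mono)
      have diag: "fst c = snd c \<or> antidiagonal c" if "c \<in># fixed_part M" for c
        using that by (auto simp: count_fixed_part split: if_splits simp flip: count_greater_zero_iff)
      show R: "fixed_part M \<in> fixed_msets f m"
        using M sub diag by (auto simp: symmetric_msets_def fixed_msets_def count_fixed_part antidiagonal_def)
      have add: "M - fixed_part M + fixed_part M = M" using fixed_part_subset by auto
      \<comment> \<open>All diagonal cells are removed, and one copy is taken from each odd
        antidiagonal multiplicity, leaving it even.\<close>
      have "fixed_part (M - fixed_part M) = {#}"
        by (rule multiset_eqI) (auto simp: count_fixed_part antidiagonal_def)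
      moreover have "swap_symmetric (M - fixed_part M)"
        using sym_iff[OF R, of "M - fixed_part M"] add M by (simp add: symmetric_msets_def)
      moreover have "size (M - fixed_part M) = n"
        using M size_Diff_submset[OF fixed_part_subset[of M]] by (simp add: symmetric_msets_def)
      moreover have "set_mset (M - fixed_part M) \<subseteq> cells m"
        using M by (auto simp: symmetric_msets_def dest: in_diffD)
      ultimately show "M - fixed_part M \<in> symmetric_msets n 0 m" by (simp add: symmetric_msets_def)
    qed
  qed
  from bij_betw_same_card[OF this] show ?thesis by (simp add: card_cartesian_product)
qed

section \<open>Generating functions of labellings and of bounded multisets\<close>

lemma labellings_nonneg: "s \<in> labellings n D m \<Longrightarrow> i \<le> n \<Longrightarrow> 0 \<le> s i"
proof (induction i)
  case (Suc i)
  then have "s i \<le> s (Suc i)" by (auto simp: labellings_def)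
  with Suc show ?case by simp
qed (simp add: labellings_def)

text \<open>Split off the last label x. At a descent the previous label is at most x - 1; the case x
  = 0 is separate because natural subtraction would turn this bound into 0.\<close>

lemma labellings_Suc_bij:
  "bij_betw (\<lambda>s. (nat (s (Suc n)), s(Suc n := 0))) (labellings (Suc n) D m)
     (SIGMA x:{..m}. if D n then (if x = 0 then {} else labellings n D (x - 1)) else labellings n D x)"
  (is "bij_betw ?f ?A ?B")
proof (rule bij_betw_byWitness[where f' = "\<lambda>(x, s). s(Suc n := int x)"])
  show "\<forall>s\<in>?A. (case ?f s of (x, s) \<Rightarrow> s(Suc n := int x)) = s"
    using labellings_nonneg by (auto simp: fun_eq_iff)
  show "\<forall>a\<in>?B. ?f (case a of (x, s) \<Rightarrow> s(Suc n := int x)) = a"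
    by (auto simp: labellings_def fun_eq_iff split: if_splits)
  show "?f ` ?A \<subseteq> ?B"
  proof
    fix y assume "y \<in> ?f ` ?A"
    then obtain s where s: "s \<in> ?A" and y: "y = ?f s" by blast
    have "0 \<le> s (Suc n)" "0 \<le> s n" using labellings_nonneg[OF s] by auto
    then show "y \<in> ?B" using s unfolding y by (auto simp: labellings_def less_Suc_eq)
  qed
  show "(\<lambda>(x, s). s(Suc n := int x)) ` ?B \<subseteq> ?A"
    by (auto simp: labellings_def less_Suc_eq split: if_splits)
qed

lemma labellings_0: "labellings 0 D m = {\<lambda>_. 0}"
proof -
  have "s i = 0" if "s \<in> labellings 0 D m" for s i
    using that by (cases "i = 0") (auto simp: labellings_def)
  moreover have "(\<lambda>_. 0) \<in> labellings 0 D m" by (simp add: labellings_def)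
  ultimately show ?thesis by blast
qed

lemma finite_labellings: "finite (labellings n D m)"
proof (induction n arbitrary: m)
  case (Suc n)
  then show ?case by (subst bij_betw_finite[OF labellings_Suc_bij]) (intro finite_SigmaI, auto)
qed (simp add: labellings_0)

lemma card_labellings_Suc:
  "card (labellings (Suc n) D m) =
     (\<Sum>x\<le>m. if D n then (if x = 0 then 0 else card (labellings n D (x - 1))) else card (labellings n D x))"
proof -
  have "card (labellings (Suc n) D m) =
     (\<Sum>x\<le>m. card (if D n then (if x = 0 then {} else labellings n D (x - 1)) else labellings n D x))"
    unfolding bij_betw_same_card[OF labellings_Suc_bij] by (rule card_SigmaI) (auto simp: finite_labellings)
  also have "\<dots> = (\<Sum>x\<le>m. if D n then (if x = 0 then 0 else card (labellings n D (x - 1))) else card (labellings n D x))"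
    by (intro sum.cong) auto
  finally show ?thesis .
qed

text \<open>Summing over the last label divides by 1 - X, and a descent shifts the bound by one, a
  factor X. The empty labelling, counted once for each m, accounts for the additional factor 1 -
  X.\<close>

lemma labellings_series:
  "Abs_fps (\<lambda>m. int (card (labellings n D m))) * (1 - fps_X) ^ (n + 1) = fps_X ^ card {i. i < n \<and> D i}"
proof (induction n)
  case 0
  show ?case by (simp add: labellings_0 fps_eq_iff right_diff_distrib)
next
  case (Suc n)
  let ?F = "\<lambda>n. Abs_fps (\<lambda>m. int (card (labellings n D m)))"
  have "?F (Suc n) * (1 - fps_X) = (if D n then fps_X else 1) * ?F n"
  proof (rule fps_ext)
    fix m show "(?F (Suc n) * (1 - fps_X)) $ m = ((if D n then fps_X else 1) * ?F n) $ m"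
      by (cases m) (auto simp: right_diff_distrib card_labellings_Suc)
  qed
  then have "?F (Suc n) * (1 - fps_X) ^ (Suc n + 1) = (if D n then fps_X else 1) * (?F n * (1 - fps_X) ^ (n + 1))"
    by (simp add: mult.assoc)
  also have "\<dots> = (if D n then fps_X else 1) * fps_X ^ card {i. i < n \<and> D i}" by (simp only: Suc.IH)
  also have "\<dots> = fps_X ^ card {i. i < Suc n \<and> D i}"
  proof (cases "D n")
    case True
    then have "{i. i < Suc n \<and> D i} = insert n {i. i < n \<and> D i}" by (auto simp: less_Suc_eq)
    then show ?thesis using True by simp
  next
    case False
    then have "{i. i < Suc n \<and> D i} = {i. i < n \<and> D i}" by (auto simp: less_Suc_eq)
    then show ?thesis using False by simp
  qed
  finally show ?case .
qed

section \<open>Series of labelled involutions\<close>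

lemma des_B_eq: "des_B n \<pi> = card {i. i < n \<and> descent_at \<pi> i}"
  unfolding des_B_def
  by (rule bij_betw_same_card[of nat], rule bij_betw_byWitness[where f' = int])
    (auto simp: descent_at_def)

lemma finite_signed_perms: "finite (signed_perms n)"
proof -
  have "inj_on (\<lambda>\<pi>. restrict \<pi> {1..int n}) (signed_perms n)"
  proof (rule inj_onI, rule ext)
    fix \<pi> \<pi>' x
    assume \<pi>: "\<pi> \<in> signed_perms n" "\<pi>' \<in> signed_perms n"
      and eq: "restrict \<pi> {1..int n} = restrict \<pi>' {1..int n}"
    have pos: "\<pi> x = \<pi>' x" if "x > 0" for x
      using \<pi> that fun_cong[OF eq, of x] by (cases "x \<le> int n") (auto simp: signed_perms_def)
    have "\<pi> (- x) = - \<pi> x" "\<pi>' (- x) = - \<pi>' x" "\<pi> (- 0) = - \<pi> 0" "\<pi>' (- 0) = - \<pi>' 0"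
      using \<pi> unfolding signed_perms_def by blast+
    then show "\<pi> x = \<pi>' x" using pos[of x] pos[of "- x"] by (cases x "0 :: int" rule: linorder_cases) auto
  qed
  moreover have "(\<lambda>\<pi>. restrict \<pi> {1..int n}) ` signed_perms n \<subseteq> {1..int n} \<rightarrow>\<^sub>E {- int n..int n}"
  proof clarify
    fix \<pi> assume "\<pi> \<in> signed_perms n"
    then have "\<bar>\<pi> i\<bar> \<in> {1..int n}" if "i \<in> {1..int n}" for i
      using that by (auto simp: signed_perms_def bij_betw_def)
    then show "restrict \<pi> {1..int n} \<in> {1..int n} \<rightarrow>\<^sub>E {- int n..int n}" by (force simp: abs_le_iff)
  qed
  ultimately show ?thesis
    by (meson finite_PiE finite_atLeastAtMost_int finite_imageD finite_subset)
qed

lemma finite_involutions_B: "finite (involutions_B n)"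
  using finite_signed_perms by (auto simp: involutions_B_def)

lemma involutions_series:
  assumes "X \<subseteq> involutions_B n"
  shows "Abs_fps (\<lambda>m. int (card {(\<pi>, s) \<in> labelled_involutions n m. \<pi> \<in> X})) * (1 - fps_X) ^ (n + 1) =
    (\<Sum>\<pi>\<in>X. fps_X ^ des_B n \<pi>)"
proof -
  have fin: "finite X" using assms finite_involutions_B finite_subset by blast
  have "card {(\<pi>, s) \<in> labelled_involutions n m. \<pi> \<in> X} = (\<Sum>\<pi>\<in>X. card (labellings n (descent_at \<pi>) m))" for m
  proof -
    have "{(\<pi>, s) \<in> labelled_involutions n m. \<pi> \<in> X} = (SIGMA \<pi>:X. labellings n (descent_at \<pi>) m)"
      using assms by (auto simp: labelled_involutions_def)
    then show ?thesis using fin by (simp add: card_SigmaI finite_labellings)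
  qed
  then have "Abs_fps (\<lambda>m. int (card {(\<pi>, s) \<in> labelled_involutions n m. \<pi> \<in> X})) =
      (\<Sum>\<pi>\<in>X. Abs_fps (\<lambda>m. int (card (labellings n (descent_at \<pi>) m))))"
    by (intro fps_ext) (simp add: fps_sum_nth)
  then show ?thesis by (simp only: sum_distrib_right labellings_series des_B_eq)
qed

section \<open>Multisets with multiplicities bounded on part of the ground set\<close>

definition bounded_msets :: "'a set \<Rightarrow> 'a set \<Rightarrow> nat \<Rightarrow> 'a multiset set" where
  "bounded_msets A B f = {R. set_mset R \<subseteq> A \<union> B \<and> (\<forall>c\<in>B. count R c \<le> 1) \<and> size R = f}"

lemma finite_bounded_msets:
  assumes "finite A" "finite B"
  shows "finite (bounded_msets A B f)"
proof (rule finite_subset)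
  show "bounded_msets A B f \<subseteq> mset ` {xs. set xs \<subseteq> A \<union> B \<and> length xs = f}"
  proof
    fix R assume R: "R \<in> bounded_msets A B f"
    obtain xs where "mset xs = R" using ex_mset by blast
    with R show "R \<in> mset ` {xs. set xs \<subseteq> A \<union> B \<and> length xs = f}"
      by (intro image_eqI[of _ _ xs]) (auto simp: bounded_msets_def)
  qed
  show "finite (mset ` {xs. set xs \<subseteq> A \<union> B \<and> length xs = f})"
    using assms by (intro finite_imageI finite_lists_length_eq) auto
qed

lemma card_bounded_msets_insert_left:
  assumes "finite A" "finite B" "a \<notin> A" "a \<notin> B"
  shows "card (bounded_msets (insert a A) B (Suc f)) =
     card (bounded_msets A B (Suc f)) + card (bounded_msets (insert a A) B f)"
proof -
  have "bounded_msets (insert a A) B (Suc f) =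
      bounded_msets A B (Suc f) \<union> add_mset a ` bounded_msets (insert a A) B f"
  proof (intro equalityI subsetI)
    fix R assume R: "R \<in> bounded_msets (insert a A) B (Suc f)"
    show "R \<in> bounded_msets A B (Suc f) \<union> add_mset a ` bounded_msets (insert a A) B f"
    proof (cases "a \<in># R")
      case True
      then obtain R' where R': "R = add_mset a R'" using multi_member_split[OF True] by blast
      have "count R' c \<le> 1" if "c \<in> B" for c
        using R that assms(4) unfolding R' by (auto simp: bounded_msets_def split: if_splits)
      then show ?thesis using R R' by (auto simp: bounded_msets_def)
    qed (use R in \<open>auto simp: bounded_msets_def\<close>)
  qed (use assms in \<open>auto simp: bounded_msets_def\<close>)
  also have "card \<dots> = card (bounded_msets A B (Suc f)) + card (add_mset a ` bounded_msets (insert a A) B f)"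
    using assms by (intro card_Un_disjoint finite_imageI finite_bounded_msets) (auto simp: bounded_msets_def)
  also have "card (add_mset a ` bounded_msets (insert a A) B f) = card (bounded_msets (insert a A) B f)"
    by (intro card_image inj_onI) auto
  finally show ?thesis .
qed

lemma card_bounded_msets_insert_right:
  assumes "finite A" "finite B" "b \<notin> A" "b \<notin> B"
  shows "card (bounded_msets A (insert b B) (Suc f)) =
     card (bounded_msets A B (Suc f)) + card (bounded_msets A B f)"
proof -
  have "bounded_msets A (insert b B) (Suc f) =
      bounded_msets A B (Suc f) \<union> add_mset b ` bounded_msets A B f"
  proof (intro equalityI subsetI)
    fix R assume R: "R \<in> bounded_msets A (insert b B) (Suc f)"
    show "R \<in> bounded_msets A B (Suc f) \<union> add_mset b ` bounded_msets A B f"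
    proof (cases "b \<in># R")
      case True
      then obtain R' where R': "R = add_mset b R'" using multi_member_split[OF True] by blast
      have "count R b \<le> 1" using R by (simp add: bounded_msets_def)
      then have "b \<notin># R'" using R' by (simp add: not_in_iff)
      moreover have "count R' c \<le> 1" if "c \<in> B" for c
        using R that assms(4) unfolding R' by (auto simp: bounded_msets_def split: if_splits)
      ultimately show ?thesis using R R' by (auto simp: bounded_msets_def)
    qed (use R in \<open>auto simp: bounded_msets_def\<close>)
  next
    fix R assume "R \<in> bounded_msets A B (Suc f) \<union> add_mset b ` bounded_msets A B f"
    moreover have "b \<notin># R" if "R \<in> bounded_msets A B g" for R g
      using that assms by (auto simp: bounded_msets_def)
    ultimately show "R \<in> bounded_msets A (insert b B) (Suc f)"
      using assms by (auto simp: bounded_msets_def not_in_iff)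
  qed
  also have "card \<dots> = card (bounded_msets A B (Suc f)) + card (add_mset b ` bounded_msets A B f)"
    using assms by (intro card_Un_disjoint finite_imageI finite_bounded_msets) (auto simp: bounded_msets_def)
  also have "card (add_mset b ` bounded_msets A B f) = card (bounded_msets A B f)"
    by (intro card_image inj_onI) auto
  finally show ?thesis .
qed

lemma bounded_msets_size_0: "bounded_msets A B 0 = {{#}}"
  by (auto simp: bounded_msets_def)

text \<open>A new element of \<open>B\<close> is present or absent, a factor 1 + X. A new element of
  \<open>A\<close> may be repeated: removing one copy gives the recursion that divides the series by
  1 - X.\<close>

lemma bounded_msets_series:
  assumes "finite A" "finite B" "A \<inter> B = {}"
  shows "Abs_fps (\<lambda>f. int (card (bounded_msets A B f))) * (1 - fps_X) ^ card A = (1 + fps_X) ^ card B"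
  using assms
proof (induction A rule: finite_induct)
  case empty
  from \<open>finite B\<close> show ?case
  proof (induction B rule: finite_induct)
    case empty
    have "bounded_msets ({} :: 'a set) {} f = (if f = 0 then {{#}} else {})" for f :: nat
      by (auto simp: bounded_msets_def)
    then show ?case by (auto intro!: fps_ext)
  next
    case (insert b B)
    have "Abs_fps (\<lambda>f. int (card (bounded_msets {} (insert b B) f))) =
        (1 + fps_X) * Abs_fps (\<lambda>f. int (card (bounded_msets {} B f)))"
    proof (rule fps_ext)
      fix f show "Abs_fps (\<lambda>f. int (card (bounded_msets {} (insert b B) f))) $ f =
        ((1 + fps_X) * Abs_fps (\<lambda>f. int (card (bounded_msets {} B f)))) $ f"
        using insert.hyps by (cases f) (auto simp: distrib_right bounded_msets_size_0 card_bounded_msets_insert_right)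
    qed
    then show ?case using insert by simp
  qed
next
  case (insert a A)
  have "Abs_fps (\<lambda>f. int (card (bounded_msets (insert a A) B f))) * (1 - fps_X) =
      Abs_fps (\<lambda>f. int (card (bounded_msets A B f)))"
  proof (rule fps_ext)
    fix f show "(Abs_fps (\<lambda>f. int (card (bounded_msets (insert a A) B f))) * (1 - fps_X)) $ f =
      Abs_fps (\<lambda>f. int (card (bounded_msets A B f))) $ f"
      using insert.hyps insert.prems
      by (cases f) (auto simp: right_diff_distrib bounded_msets_size_0 card_bounded_msets_insert_left)
  qed
  moreover have "card (insert a A) = Suc (card A)" using insert.hyps by simp
  ultimately show ?case using insert by (simp add: mult.assoc flip: mult.assoc)
qed

lemma fixed_msets_series:
  "Abs_fps (\<lambda>f. int (card (fixed_msets f m))) * (1 - fps_X) ^ (m + 1) = (1 + fps_X) ^ m"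
proof -
  let ?A = "{c \<in> cells m. fst c = snd c}" and ?B = "{c \<in> cells m. antidiagonal c}"
  have A: "bij_betw (\<lambda>a. (a, a)) {0..int m} ?A"
    by (rule bij_betw_byWitness[where f' = fst]) (auto simp: cells_def zero_prod_def)
  have B: "bij_betw (\<lambda>a. (a, - a)) {1..int m} ?B"
    by (rule bij_betw_byWitness[where f' = fst]) (auto simp: cells_def zero_prod_def antidiagonal_def)
  have "card ?A = m + 1" "card ?B = m" "finite ?A" "finite ?B"
    using bij_betw_same_card[OF A] bij_betw_same_card[OF B] bij_betw_finite[OF A] bij_betw_finite[OF B] by auto
  moreover have "?A \<inter> ?B = {}" by (auto simp: antidiagonal_def)
  ultimately show ?thesis
    using bounded_msets_series[of ?A ?B] by (simp add: fixed_msets_def bounded_msets_def)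
qed

section \<open>Substitution in double power series\<close>

text \<open>One predicate covers all maps applied to identities below: embedding of constants,
  exchange of variables, rescaling and evaluation. Rewriting with \<open>ring_hom_simps\<close> then
  transports an identity in one step.\<close>

definition is_ring_hom :: "('a :: comm_ring_1 \<Rightarrow> 'b :: comm_ring_1) \<Rightarrow> bool" where
  "is_ring_hom h \<longleftrightarrow> h 1 = 1 \<and> (\<forall>a b. h (a + b) = h a + h b) \<and> (\<forall>a b. h (a * b) = h a * h b)"

context
  fixes h :: "'a :: comm_ring_1 \<Rightarrow> 'b :: comm_ring_1"
  assumes hom: "is_ring_hom h"
begin

lemma ring_hom_one: "h 1 = 1"
  and ring_hom_add: "h (a + b) = h a + h b"
  and ring_hom_mult: "h (a * b) = h a * h b"
  using hom by (auto simp: is_ring_hom_def)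

lemma ring_hom_zero: "h 0 = 0"
  using ring_hom_add[of 0 0] by simp

lemma ring_hom_uminus: "h (- a) = - h a"
  using ring_hom_add[of a "- a"] ring_hom_zero by (simp add: eq_neg_iff_add_eq_0 add.commute)

lemma ring_hom_diff: "h (a - b) = h a - h b"
  using ring_hom_add[of a "- b"] ring_hom_uminus by simp

lemma ring_hom_power: "h (a ^ n) = h a ^ n"
  by (induction n) (simp_all add: ring_hom_one ring_hom_mult)

lemma ring_hom_sum: "h (\<Sum>x\<in>A. f x) = (\<Sum>x\<in>A. h (f x))"
  by (induction A rule: infinite_finite_induct) (simp_all add: ring_hom_zero ring_hom_add)

lemma ring_hom_of_nat: "h (of_nat n) = of_nat n"
  by (induction n) (simp_all add: ring_hom_zero ring_hom_add ring_hom_one)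

lemma ring_hom_of_int: "h (of_int k) = of_int k"
  by (cases k) (simp_all add: ring_hom_of_nat ring_hom_uminus ring_hom_diff ring_hom_one)

lemma ring_hom_numeral: "h (numeral k) = numeral k"
  using ring_hom_of_nat[of "numeral k"] by simp

lemmas ring_hom_simps = ring_hom_one ring_hom_add ring_hom_mult ring_hom_zero ring_hom_uminus
  ring_hom_diff ring_hom_power ring_hom_sum ring_hom_of_nat ring_hom_of_int ring_hom_numeral

end

lemma is_ring_hom_comp: "is_ring_hom g \<Longrightarrow> is_ring_hom h \<Longrightarrow> is_ring_hom (\<lambda>x. g (h x))"
  by (simp add: is_ring_hom_def)

lemma is_ring_hom_fps_const: "is_ring_hom fps_const"
  by (simp add: is_ring_hom_def fps_const_mult fps_const_add)

lemma is_ring_hom_fps_of_poly: "is_ring_hom fps_of_poly"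
  by (simp add: is_ring_hom_def fps_of_poly_add fps_of_poly_mult)

lemma is_ring_hom_to_fract: "is_ring_hom to_fract"
  by (simp add: is_ring_hom_def)

lemma is_ring_hom_const_poly: "is_ring_hom (\<lambda>c. [:c:])"
  by (simp add: is_ring_hom_def one_pCons)

text \<open>Exchange of the outer and the inner variable. It is needed because
  \<open>fps_scale\<close> acts on the outer variable only, and both variables get rescaled in
  turn.\<close>

definition fps_swap :: "'a fps fps \<Rightarrow> 'a fps fps" where
  "fps_swap F = Abs_fps (\<lambda>m. Abs_fps (\<lambda>f. F $ f $ m))"

lemma fps_swap_nth [simp]: "fps_swap F $ m $ f = F $ f $ m"
  by (simp add: fps_swap_def)

lemma is_ring_hom_fps_swap: "is_ring_hom (fps_swap :: 'a :: comm_ring_1 fps fps \<Rightarrow> _)"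
proof -
  have "fps_swap (F * G) = fps_swap F * fps_swap G" for F G :: "'a fps fps"
  proof (intro fps_ext)
    fix m f
    have "fps_swap (F * G) $ m $ f = (\<Sum>i=0..f. \<Sum>k=0..m. F $ i $ k * G $ (f - i) $ (m - k))"
      by (simp add: fps_mult_nth fps_sum_nth)
    also have "\<dots> = (\<Sum>k=0..m. \<Sum>i=0..f. F $ i $ k * G $ (f - i) $ (m - k))" by (rule sum.swap)
    also have "\<dots> = (fps_swap F * fps_swap G) $ m $ f"
      by (simp add: fps_mult_nth fps_sum_nth)
    finally show "fps_swap (F * G) $ m $ f = (fps_swap F * fps_swap G) $ m $ f" .
  qed
  moreover have "fps_swap (1 :: 'a fps fps) = 1" by (intro fps_ext) simp
  moreover have "fps_swap (F + G) = fps_swap F + fps_swap G" for F G :: "'a fps fps" by (intro fps_ext) simp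
  ultimately show ?thesis by (simp add: is_ring_hom_def)
qed

lemma fps_swap_X: "fps_swap fps_X = fps_const fps_X" "fps_swap (fps_const fps_X) = fps_X"
  by (intro fps_ext; simp add: fps_X_def fps_const_def)+

text \<open>The substitution X -> c X, stated on coefficients; for double series \<open>c\<close> is
  itself a series in the inner variable.\<close>

definition fps_scale :: "'a :: comm_ring_1 \<Rightarrow> 'a fps \<Rightarrow> 'a fps" where
  "fps_scale c F = Abs_fps (\<lambda>n. c ^ n * F $ n)"

lemma is_ring_hom_fps_scale: "is_ring_hom (fps_scale c)"
proof -
  have "fps_scale c (F * G) = fps_scale c F * fps_scale c G" for F G
  proof (rule fps_ext)
    fix n
    have "c ^ n * (F * G) $ n = (\<Sum>i=0..n. c ^ i * F $ i * (c ^ (n - i) * G $ (n - i)))"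
      unfolding fps_mult_nth sum_distrib_left
    proof (intro sum.cong refl)
      fix i assume "i \<in> {0..n}"
      then have "c ^ n = c ^ i * c ^ (n - i)" by (simp flip: power_add)
      then show "c ^ n * (F $ i * G $ (n - i)) = c ^ i * F $ i * (c ^ (n - i) * G $ (n - i))"
        by (simp add: ac_simps)
    qed
    then show "fps_scale c (F * G) $ n = (fps_scale c F * fps_scale c G) $ n"
      by (simp add: fps_scale_def fps_mult_nth)
  qed
  moreover have "fps_scale c 1 = 1" by (rule fps_ext) (simp add: fps_scale_def)
  moreover have "fps_scale c (F + G) = fps_scale c F + fps_scale c G" for F G
    by (rule fps_ext) (simp add: fps_scale_def algebra_simps)
  ultimately show ?thesis by (simp add: is_ring_hom_def)
qed

lemma fps_scale_X: "fps_scale c fps_X = fps_const c * fps_X"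
  by (rule fps_ext) (auto simp: fps_scale_def fps_X_def)

lemma fps_scale_const: "fps_scale c (fps_const a) = fps_const a"
  by (rule fps_ext) (simp add: fps_scale_def)

lemma is_ring_hom_poly_map_poly:
  assumes h: "is_ring_hom h"
  shows "is_ring_hom (\<lambda>p. poly (map_poly h p) y)"
proof -
  note h_simps = ring_hom_simps[OF h]
  let ?E = "\<lambda>p. poly (map_poly h p) y"
  have pCons: "?E (pCons a p) = h a + y * ?E p" for a p
    by (simp add: map_poly_pCons h_simps)
  have add: "?E (p + q) = ?E p + ?E q" for p q
    by (induction p q rule: poly_induct2) (auto simp: pCons h_simps algebra_simps)
  have smult: "?E (smult c p) = h c * ?E p" for c p
    by (induction p) (auto simp: pCons h_simps algebra_simps)
  have "?E (p * q) = ?E p * ?E q" for p q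
    by (induction p) (auto simp: pCons add smult h_simps algebra_simps)
  then show ?thesis using add by (simp add: is_ring_hom_def h_simps)
qed

text \<open>For P with coefficients \<open>D\<close> this is b^(2j) P(a / b^2) with the denominators
  cleared, which makes sense in every commutative ring.\<close>

definition qform :: "nat \<Rightarrow> (nat \<Rightarrow> int) \<Rightarrow> 'a \<Rightarrow> 'a \<Rightarrow> 'a :: comm_ring_1" where
  "qform j D a b = (\<Sum>s\<le>j. of_int (D s) * a ^ s * b ^ (2 * j - 2 * s))"

lemma qform_hom: "is_ring_hom h \<Longrightarrow> h (qform j D a b) = qform j D (h a) (h b)"
  by (simp add: qform_def ring_hom_simps)

text \<open>The form is homogeneous of degree 2j when \<open>a\<close> has degree 2 and
  \<open>b\<close> degree 1. This replaces all cancelling of denominators.\<close>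

lemma qform_scale: "r ^ (2 * j) * qform j D a b = qform j D (r ^ 2 * a) (r * b)"
  unfolding qform_def sum_distrib_left
proof (intro sum.cong refl)
  fix s assume "s \<in> {..j}"
  then have "r ^ (2 * j) = r ^ (2 * s) * r ^ (2 * j - 2 * s)" by (simp flip: power_add)
  then show "r ^ (2 * j) * (of_int (D s) * a ^ s * b ^ (2 * j - 2 * s)) =
      of_int (D s) * (r\<^sup>2 * a) ^ s * (r * b) ^ (2 * j - 2 * s)"
    by (simp add: power_mult_distrib ac_simps flip: power_mult)
qed

text \<open>
  With \<open>q = (1 + v) / (1 - v)\<close>, the coefficient of \<open>t^m\<close> in the double series with terms
  \<open>G $ m * C m\<close> is \<open>G $ m * q^m / (1 - v)\<close>. So it arises from \<open>G(t)\<close> by the substitution \<open>t \<mapsto> q t\<close>, which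
  transforms \<open>G(t) = J(t) / (1 - t)^(2j+1)\<close>; then \<open>v\<close> is rescaled to \<open>(1 - t) v\<close>.
\<close>

lemma double_series:
  fixes G :: "int fps" and C :: "nat \<Rightarrow> int fps"
  defines "a \<equiv> fps_const fps_X :: int fps fps" and "b \<equiv> fps_X :: int fps fps"
  assumes G: "G * (1 - fps_X) ^ (2 * j + 1) = qform j D fps_X (1 + fps_X)"
    and C: "\<And>m. C m * (1 - fps_X) ^ (m + 1) = (1 + fps_X) ^ m"
  shows "Abs_fps (\<lambda>f. Abs_fps (\<lambda>m. G $ m * C m $ f) * (1 - fps_X) ^ (2 * j + f + 1))
      * (1 - (1 + a) * b) ^ (2 * j + 1) =
    qform j D (a * (1 - ((1 - a) * b) ^ 2)) (1 + a - (1 - a) ^ 2 * b)"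
proof -
  define g :: "int fps" where "g = Abs_fps (\<lambda>_. 1)"
  have g: "g * (1 - fps_X) = 1"
    by (rule fps_ext) (simp add: g_def right_diff_distrib)
  have C_eq: "C m = (g * (1 + fps_X)) ^ m * g" for m
  proof -
    have "C m = C m * (g * (1 - fps_X)) ^ (m + 1)" by (simp add: g)
    also have "\<dots> = C m * (1 - fps_X) ^ (m + 1) * g ^ (m + 1)" by (simp only: power_mult_distrib ac_simps)
    also have "\<dots> = (1 + fps_X) ^ m * g ^ (m + 1)" by (simp only: C)
    finally show ?thesis by (simp only: power_mult_distrib power_add power_one_right ac_simps)
  qed
  define q where "q = g * (1 + fps_X)"
  \<comment> \<open>\<open>G1\<close> is G in the outer variable, with constant coefficients. From
    here until \<open>H\<close> is swapped, \<open>b\<close> stands for t and \<open>a\<close> for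
    v; in the conclusion the roles are reversed.\<close>
  define G1 where "G1 = fps_swap (fps_const G)"
  have lift: "is_ring_hom (\<lambda>x :: int fps. fps_swap (fps_const x))"
    by (rule is_ring_hom_comp[OF is_ring_hom_fps_swap is_ring_hom_fps_const])
  have 1: "G1 * (1 - b) ^ (2 * j + 1) = qform j D b (1 + b)"
    using arg_cong[OF G, of "\<lambda>x. fps_swap (fps_const x)"]
    by (simp only: ring_hom_simps[OF lift] qform_hom[OF lift] fps_swap_X G1_def b_def)
  have G1_nth: "G1 $ m = fps_const (G $ m)" for m
    by (rule fps_ext) (auto simp: G1_def)
  define G2 where "G2 = fps_scale q G1"
  have 2: "G2 * (1 - fps_const q * b) ^ (2 * j + 1) = qform j D (fps_const q * b) (1 + fps_const q * b)"
    using arg_cong[OF 1, of "fps_scale q"]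
    by (simp only: ring_hom_simps[OF is_ring_hom_fps_scale] qform_hom[OF is_ring_hom_fps_scale] fps_scale_X G2_def b_def)
  have ga: "fps_const g * (1 - a) = 1"
    using arg_cong[OF g, of fps_const] unfolding ring_hom_simps[OF is_ring_hom_fps_const] a_def by simp
  have q_eq: "fps_const q = fps_const g * (1 + a)"
    unfolding q_def a_def by (simp only: ring_hom_simps[OF is_ring_hom_fps_const])
  have qa: "(1 - a) * fps_const q = 1 + a"
  proof -
    have "(1 - a) * fps_const q = (fps_const g * (1 - a)) * (1 + a)" by (simp only: q_eq ac_simps)
    then show ?thesis by (simp only: ga mult_1_left)
  qed
  define H where "H = fps_const g * G2"
  \<comment> \<open>Multiply by (1 - a)^(2j+1) to remove the denominator of q: homogeneity of the
    form absorbs 2j of the factors, and the last one cancels against the factor g = 1 / (1 - v) in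
    \<open>H\<close>.\<close>
  have 3: "H * ((1 - a) - (1 + a) * b) ^ (2 * j + 1) = qform j D ((1 - a) * (1 + a) * b) ((1 - a) + (1 + a) * b)"
  proof -
    have "(1 - a) - (1 + a) * b = (1 - a) * (1 - fps_const q * b)"
      unfolding qa[symmetric] by (simp add: algebra_simps)
    then have "H * ((1 - a) - (1 + a) * b) ^ (2 * j + 1) =
        (fps_const g * (1 - a)) * (1 - a) ^ (2 * j) * (G2 * (1 - fps_const q * b) ^ (2 * j + 1))"
      by (simp add: H_def power_mult_distrib ac_simps)
    also have "\<dots> = qform j D ((1 - a) ^ 2 * (fps_const q * b)) ((1 - a) * (1 + fps_const q * b))"
      by (simp only: ga 2 mult_1_left qform_scale)
    also have "(1 - a) ^ 2 * (fps_const q * b) = (1 - a) * (1 + a) * b"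
      unfolding qa[symmetric] by (simp add: power2_eq_square ac_simps)
    also have "(1 - a) * (1 + fps_const q * b) = (1 - a) + (1 + a) * b"
      unfolding qa[symmetric] by (simp add: algebra_simps)
    finally show ?thesis .
  qed
  have swap_ab: "fps_swap a = b" "fps_swap b = a" by (simp_all add: a_def b_def fps_swap_X)
  have 4: "fps_swap H * ((1 - b) - (1 + b) * a) ^ (2 * j + 1) = qform j D ((1 - b) * (1 + b) * a) ((1 - b) + (1 + b) * a)"
    using arg_cong[OF 3, of fps_swap]
    by (simp only: ring_hom_simps[OF is_ring_hom_fps_swap] qform_hom[OF is_ring_hom_fps_swap] swap_ab)
  \<comment> \<open>Scaling v by 1 - t multiplies the coefficient of v^f by (1 - t)^f, the part of
    the factor (1 - t)^(2j+f+1) that varies with f.\<close>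
  let ?\<sigma> = "fps_scale (1 - fps_X :: int fps)"
  have scale_ab: "?\<sigma> a = a" "?\<sigma> b = (1 - a) * b"
    by (simp_all add: a_def b_def fps_scale_X fps_scale_const flip: fps_const_1_eq_1 fps_const_sub)
  define H3 where "H3 = ?\<sigma> (fps_swap H)"
  have 5: "H3 * ((1 - (1 - a) * b) - (1 + (1 - a) * b) * a) ^ (2 * j + 1) =
      qform j D ((1 - (1 - a) * b) * (1 + (1 - a) * b) * a) ((1 - (1 - a) * b) + (1 + (1 - a) * b) * a)"
    using arg_cong[OF 4, of ?\<sigma>]
    by (simp only: ring_hom_simps[OF is_ring_hom_fps_scale] qform_hom[OF is_ring_hom_fps_scale] scale_ab H3_def)
  have "Abs_fps (\<lambda>f. Abs_fps (\<lambda>m. G $ m * C m $ f) * (1 - fps_X) ^ (2 * j + f + 1)) = H3 * (1 - a) ^ (2 * j + 1)"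
  proof (rule fps_ext)
    fix f
    have "Abs_fps (\<lambda>m. G $ m * C m $ f) = fps_swap H $ f"
    proof (rule fps_ext)
      fix m
      have "H $ m = fps_const (G $ m) * C m"
        unfolding H_def G2_def fps_scale_def by (simp add: G1_nth C_eq q_def ac_simps)
      then show "Abs_fps (\<lambda>m. G $ m * C m $ f) $ m = fps_swap H $ f $ m" by simp
    qed
    moreover have "(1 - a) ^ (2 * j + 1) = fps_const ((1 - fps_X) ^ (2 * j + 1))"
      unfolding a_def by (simp only: ring_hom_simps[OF is_ring_hom_fps_const])
    ultimately show "Abs_fps (\<lambda>f. Abs_fps (\<lambda>m. G $ m * C m $ f) * (1 - fps_X) ^ (2 * j + f + 1)) $ f =
        (H3 * (1 - a) ^ (2 * j + 1)) $ f"
      by (simp add: H3_def fps_scale_def power_add ac_simps)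
  qed
  note lhs = this
  \<comment> \<open>The scaled denominator splits off a factor 1 - a, whose power 2j + 1 supplies
    the remaining part of that factor.\<close>
  have base: "(1 - a) * (1 - (1 + a) * b) = (1 - (1 - a) * b) - (1 + (1 - a) * b) * a"
    by (simp add: algebra_simps)
  have "Abs_fps (\<lambda>f. Abs_fps (\<lambda>m. G $ m * C m $ f) * (1 - fps_X) ^ (2 * j + f + 1))
      * (1 - (1 + a) * b) ^ (2 * j + 1) = H3 * ((1 - (1 - a) * b) - (1 + (1 - a) * b) * a) ^ (2 * j + 1)"
    unfolding lhs base[symmetric] by (simp only: power_mult_distrib mult.assoc)
  also note 5
  also have "(1 - (1 - a) * b) * (1 + (1 - a) * b) * a = a * (1 - ((1 - a) * b) ^ 2)"
    by (simp add: algebra_simps power2_eq_square)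
  also have "(1 - (1 - a) * b) + (1 + (1 - a) * b) * a = 1 + a - (1 - a) ^ 2 * b"
    by (simp add: algebra_simps power2_eq_square)
  finally show ?thesis .
qed

section \<open>The polynomials \<open>P\<^sub>j\<close> and \<open>A\<^sub>j\<^sub>,\<^sub>r\<close>\<close>

lemma fix_B_plus_cyc2:
  assumes \<pi>: "\<pi> \<in> involutions_B n"
  shows "fix_B n \<pi> + 2 * cyc2 n \<pi> = n"
proof -
  define \<tau> where "\<tau> i = \<bar>\<pi> i\<bar>" for i
  define X where "X = {i \<in> {1..int n}. \<tau> i \<noteq> i}"
  have \<tau>_in: "\<tau> i \<in> {1..int n}" if "i \<in> {1..int n}" for i
    using \<pi> that by (auto simp: \<tau>_def involutions_B_def signed_perms_def bij_betw_def)
  have \<tau>_\<tau>: "\<tau> (\<tau> i) = i" if "i \<in> {1..int n}" for i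
    using that involutions_B_apply[OF \<pi>] by (auto simp: \<tau>_def abs_if)
  have \<tau>_X: "\<tau> i \<in> X" if "i \<in> X" for i
    using that \<tau>_in[of i] \<tau>_\<tau>[of i] by (auto simp: X_def)
  let ?C = "(\<lambda>i. {i, \<tau> i}) ` X"
  \<comment> \<open>Orbits of the involution i -> |\<pi> i| that share a point coincide, so the
    non-fixed points are counted by disjoint pairs.\<close>
  have "card (\<Union>?C) = (\<Sum>S\<in>?C. card S)"
  proof (rule card_Union_disjoint)
    have "{i, \<tau> i} = {k, \<tau> k}" if "i \<in> X" "k \<in> X" "x \<in> {i, \<tau> i}" "x \<in> {k, \<tau> k}" for i k x
    proof -
      have "\<tau> (\<tau> i) = i" "\<tau> (\<tau> k) = k" using that \<tau>_\<tau> by (auto simp: X_def)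
      then show ?thesis using that(3,4) by (elim insertE emptyE; metis insert_commute)
    qed
    then show "pairwise disjnt ?C"
      unfolding pairwise_def disjnt_def by blast
  qed auto
  also have "\<Union>?C = X" using \<tau>_X by auto
  also have "(\<Sum>S\<in>?C. card S) = (\<Sum>S\<in>?C. 2)"
    by (intro sum.cong) (auto simp: X_def card_2_iff)
  also have "?C = {{i, \<bar>\<pi> i\<bar>} | i. i \<in> {1..int n} \<and> \<bar>\<pi> i\<bar> \<noteq> i}"
    by (auto simp: X_def \<tau>_def)
  finally have "card X = 2 * cyc2 n \<pi>" by (simp add: cyc2_def)
  moreover have "card {1..int n} = card ({i \<in> {1..int n}. \<bar>\<pi> i\<bar> = i} \<union> X)"
    by (intro arg_cong[where f = card]) (auto simp: X_def \<tau>_def)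
  moreover have "card ({i \<in> {1..int n}. \<bar>\<pi> i\<bar> = i} \<union> X) = fix_B n \<pi> + card X"
    unfolding fix_B_def X_def \<tau>_def by (rule card_Un_disjoint) (auto intro: finite_subset[of _ "{1..int n}"])
  ultimately show ?thesis by simp
qed

lemma F_cyc_fix_eq:
  "F_cyc_fix j f = (\<Sum>\<pi> | \<pi> \<in> involutions_B (2 * j + f) \<and> fix_B (2 * j + f) \<pi> = f. monom 1 (des_B (2 * j + f) \<pi>))"
  unfolding F_cyc_fix_def
proof (intro sum.cong refl Collect_cong)
  fix \<pi>
  show "(\<pi> \<in> involutions_B (2 * j + f) \<and> cyc2 (2 * j + f) \<pi> = j \<and> fix_B (2 * j + f) \<pi> = f) \<longleftrightarrow>
    (\<pi> \<in> involutions_B (2 * j + f) \<and> fix_B (2 * j + f) \<pi> = f)"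
    using fix_B_plus_cyc2[of \<pi> "2 * j + f"] by auto
qed

lemma fps_of_poly_linear: "fps_of_poly [:0, 1 :: int:] = fps_X" "fps_of_poly [:1, 1 :: int:] = 1 + fps_X"
  by (rule fps_ext; simp add: coeff_pCons fps_X_def split: nat.splits)+

lemma F_cyc_fix_series:
  "Abs_fps (\<lambda>m. int (card (symmetric_msets (2 * j + f) f m))) * (1 - fps_X) ^ (2 * j + f + 1) =
     fps_of_poly (F_cyc_fix j f)"
proof -
  let ?X = "{\<pi> \<in> involutions_B (2 * j + f). fix_B (2 * j + f) \<pi> = f}"
  have "{(\<pi>, s) \<in> labelled_involutions (2 * j + f) m. \<pi> \<in> ?X} =
      {(\<pi>, s) \<in> labelled_involutions (2 * j + f) m. fix_B (2 * j + f) \<pi> = f}" for m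
    by (auto simp: labelled_involutions_def)
  moreover have "fps_of_poly (F_cyc_fix j f) = (\<Sum>\<pi>\<in>?X. fps_X ^ des_B (2 * j + f) \<pi>)"
    by (simp add: F_cyc_fix_eq fps_of_poly_sum fps_of_poly_monom)
  ultimately show ?thesis
    using involutions_series[of ?X "2 * j + f"] by (simp add: card_labelled_involutions)
qed

section \<open>Polynomial forms of the definitions of P and A\<close>

lemma poly_map_poly_of_int:
  fixes y :: "'a :: comm_ring_1"
  assumes "degree P \<le> j"
  shows "poly (map_poly of_int P) y = (\<Sum>s\<le>j. of_int (coeff P s) * y ^ s)"
proof -
  have "poly (map_poly of_int P) y = (\<Sum>s\<le>degree (map_poly of_int P :: 'a poly). of_int (coeff P s) * y ^ s)"
    by (simp add: poly_altdef coeff_map_poly)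
  also have "\<dots> = (\<Sum>s\<le>j. of_int (coeff P s) * y ^ s)"
  proof (rule sum.mono_neutral_left)
    have "degree (map_poly of_int P :: 'a poly) \<le> degree P" by (rule map_poly_degree_leq)
    then show "{..degree (map_poly of_int P :: 'a poly)} \<subseteq> {..j}" using assms by auto
    show "\<forall>s\<in>{..j} - {..degree (map_poly of_int P :: 'a poly)}. of_int (coeff P s) * y ^ s = 0"
    proof
      fix s assume "s \<in> {..j} - {..degree (map_poly of_int P :: 'a poly)}"
      then have "coeff (map_poly of_int P :: 'a poly) s = 0" by (intro coeff_eq_0) auto
      then show "of_int (coeff P s) * y ^ s = 0" by (simp add: coeff_map_poly)
    qed
  qed auto
  finally show ?thesis .
qed

lemma poly_map_poly_of_int_qform: "degree P \<le> j \<Longrightarrow> poly (map_poly of_int P) y = qform j (coeff P) y 1"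
  by (simp add: poly_map_poly_of_int qform_def)

text \<open>The factor (1+t)^(2j) clears the denominators by \<open>qform_scale\<close>, and
  \<open>to_fract\<close> is injective, so the identity of rational functions is one of
  polynomials.\<close>

lemma is_P_iff: "is_P j P \<longleftrightarrow> degree P \<le> j \<and> J_B j = qform j (coeff P) [:0, 1:] [:1, 1:]"
proof (cases "degree P \<le> j")
  case True
  define t where "t = to_fract [:0, 1 :: int:]"
  have one_t: "1 + t = to_fract [:1, 1:]"
    by (simp add: t_def one_pCons flip: to_fract_1 to_fract_add)
  have ne: "1 + t \<noteq> 0" unfolding one_t by simp
  have "(1 + t) ^ (2 * j) * poly (map_poly of_int P) (t / (1 + t) ^ 2) =
      qform j (coeff P) ((1 + t) ^ 2 * (t / (1 + t) ^ 2)) ((1 + t) * 1)"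
    using True by (simp only: poly_map_poly_of_int_qform qform_scale)
  also have "\<dots> = qform j (coeff P) t (1 + t)" using ne by simp
  also have "\<dots> = to_fract (qform j (coeff P) [:0, 1:] [:1, 1:])"
    by (simp only: one_t qform_hom[OF is_ring_hom_to_fract]) (simp only: t_def)
  finally show ?thesis using True by (simp add: is_P_def Let_def t_def)
qed (simp add: is_P_def)

text \<open>The product t^i (1 + t)^e starts with t^i and leading coefficient 1 at that end. This
  triangularity is what makes P unique.\<close>

lemma coeff_qform:
  assumes "s \<le> j" "\<And>i. i < s \<Longrightarrow> D i = 0"
  shows "coeff (qform j D [:0, 1:] [:1, 1:]) s = D s"
proof -
  have term_eq: "of_int (D i) * [:0, 1:] ^ i * [:1, 1:] ^ e = smult (D i) (monom 1 i * [:1, 1:] ^ e)" for i e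
    by (simp add: of_int_poly monom_altdef)
  have 0: "coeff ([:1, 1 :: int:] ^ e) 0 = 1" for e
    by (simp add: coeff_0_power)
  have "coeff (qform j D [:0, 1:] [:1, 1:]) s = (\<Sum>i\<le>j. if i = s then D s else 0)"
    unfolding qform_def coeff_sum
  proof (intro sum.cong refl)
    fix i
    show "coeff (of_int (D i) * [:0, 1:] ^ i * [:1, 1:] ^ (2 * j - 2 * i)) s = (if i = s then D s else 0)"
      unfolding term_eq coeff_smult coeff_monom_mult using assms(2)[of i] 0
      by (cases i s rule: linorder_cases) auto
  qed
  then show ?thesis using assms(1) by simp
qed

lemma qform_inject:
  assumes "qform j D [:0, 1:] [:1, 1:] = qform j D' [:0, 1:] [:1, 1 :: int:]" "s \<le> j"
  shows "D s = D' s"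
  using \<open>s \<le> j\<close>
proof (induction s rule: less_induct)
  case (less s)
  have "qform j (\<lambda>s. D s - D' s) [:0, 1:] [:1, 1 :: int:] = 0"
    using assms(1) by (simp add: qform_def algebra_simps sum_subtractf)
  moreover have "coeff (qform j (\<lambda>s. D s - D' s) [:0, 1:] [:1, 1:]) s = D s - D' s"
    using less by (intro coeff_qform) auto
  ultimately show ?case by simp
qed

lemma P_poly_eq:
  assumes "is_P j P"
  shows "P_poly j = P"
  unfolding P_poly_def
proof (rule the_equality)
  fix P' assume "is_P j P'"
  with assms have deg: "degree P \<le> j" "degree P' \<le> j"
    and eq: "qform j (coeff P') [:0, 1:] [:1, 1:] = qform j (coeff P) [:0, 1:] [:1, 1 :: int:]"
    by (auto simp: is_P_iff)
  show "P' = P"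
  proof (rule poly_eqI)
    fix s show "coeff P' s = coeff P s"
      using qform_inject[OF eq, of s] deg by (cases "s \<le> j") (auto simp: coeff_eq_0)
  qed
qed (fact assms)

text \<open>The generating function of the A_{j,r} after clearing denominators, as a polynomial in W
  (outer variable) over polynomials in x. Its coefficients in W are visibly polynomials in
  x.\<close>

definition A_bipoly :: "nat \<Rightarrow> (nat \<Rightarrow> int) \<Rightarrow> int poly poly" where
  "A_bipoly j D =
     (let x = [:[:0, 1:]:]; W = [:0, 1:]
      in qform j D (x * (1 + 2 * W + 4 * x * W ^ 2)) (1 + 4 * x * W))"

lemma is_ring_hom_bipoly_fps: "is_ring_hom (\<lambda>Q :: int poly poly. Abs_fps (\<lambda>r. to_fract (coeff Q r)))"
proof -
  have "Abs_fps (\<lambda>r. to_fract (coeff (P * Q) r)) = Abs_fps (\<lambda>r. to_fract (coeff P r)) * Abs_fps (\<lambda>r. to_fract (coeff Q r))"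
    for P Q :: "int poly poly"
    by (rule fps_ext) (simp add: coeff_mult fps_mult_nth ring_hom_simps[OF is_ring_hom_to_fract] atMost_atLeast0)
  moreover have "Abs_fps (\<lambda>r. to_fract (coeff (1 :: int poly poly) r)) = 1"
    by (rule fps_ext) (simp add: coeff_1)
  moreover have "Abs_fps (\<lambda>r. to_fract (coeff (P + Q) r)) = Abs_fps (\<lambda>r. to_fract (coeff P r)) + Abs_fps (\<lambda>r. to_fract (coeff Q r))"
    for P Q :: "int poly poly"
    by (rule fps_ext) simp
  ultimately show ?thesis by (simp add: is_ring_hom_def)
qed

text \<open>The prefactor (1+4xW)^(2j) clears all denominators by homogeneity. Comparing
  coefficients then determines the polynomials, because \<open>to_fract\<close> is
  injective.\<close>

lemma A_poly_eq:
  assumes "is_P j P"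
  shows "A_poly j = coeff (A_bipoly j (coeff P))"
proof -
  let ?E = "\<lambda>Q :: int poly poly. Abs_fps (\<lambda>r. to_fract (coeff Q r))"
  note E_simps = ring_hom_simps[OF is_ring_hom_bipoly_fps]
  define x where "x = fps_const (to_fract [:0, 1 :: int:])"
  have x: "?E [:[:0, 1:]:] = x" and W: "?E [:0, 1:] = fps_X"
    by (rule fps_ext; simp add: x_def coeff_pCons fps_X_def split: nat.splits)+
  define b where "b = 1 + 4 * x * fps_X"
  \<comment> \<open>A nonzero constant term over a field makes the series a unit, so the quotient of
    series really cancels.\<close>
  have "b ^ 2 $ 0 \<noteq> 0" by (simp add: b_def power2_eq_square)
  then have "b ^ 2 dvd c" for c by (rule fps_unit_dvd)
  then have cancel: "b ^ 2 * (c / b ^ 2) = c" for c by (rule dvd_mult_div_cancel)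
  have deg: "degree P \<le> j" using assms by (simp add: is_P_iff)
  have "A_genfun j = b ^ (2 * j) * poly (map_poly of_int P) (x * (1 + 2 * fps_X + 4 * x * fps_X ^ 2) / b ^ 2)"
    by (simp only: A_genfun_def Let_def P_poly_eq[OF assms] flip: x_def b_def)
  also have "\<dots> = qform j (coeff P) (b ^ 2 * (x * (1 + 2 * fps_X + 4 * x * fps_X ^ 2) / b ^ 2)) (b * 1)"
    by (simp only: poly_map_poly_of_int_qform[OF deg] qform_scale)
  also have "\<dots> = qform j (coeff P) (x * (1 + 2 * fps_X + 4 * x * fps_X ^ 2)) b"
    by (simp only: cancel mult_1_right)
  also have "\<dots> = ?E (A_bipoly j (coeff P))"
    unfolding A_bipoly_def Let_def qform_hom[OF is_ring_hom_bipoly_fps] E_simps x W b_def ..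
  finally have gen: "A_genfun j = ?E (A_bipoly j (coeff P))" .
  show ?thesis
    unfolding A_poly_def gen
    by (rule the_equality) (auto simp: fps_eq_iff)
qed

text \<open>With weight 2 for x and weight -1 for W, all monomials have weight at most
  \<open>d\<close>; in addition all coefficients are nonnegative. Both properties pass to sums and
  products.\<close>

definition weighted :: "nat \<Rightarrow> int poly poly \<Rightarrow> bool" where
  "weighted d Q \<longleftrightarrow> (\<forall>r k. 0 \<le> coeff (coeff Q r) k \<and> (coeff (coeff Q r) k \<noteq> 0 \<longrightarrow> 2 * k \<le> d + r))"

lemma weighted_add: "weighted d P \<Longrightarrow> weighted d Q \<Longrightarrow> weighted d (P + Q)"
  unfolding weighted_def coeff_add by (metis add.right_neutral add_0 add_nonneg_nonneg)

lemma weighted_mult: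
  assumes P: "weighted d P" and Q: "weighted e Q"
  shows "weighted (d + e) (P * Q)"
  unfolding weighted_def
proof (intro allI conjI impI)
  fix r k
  have coeff: "coeff (coeff (P * Q) r) k =
      (\<Sum>i\<le>r. \<Sum>l\<le>k. coeff (coeff P i) l * coeff (coeff Q (r - i)) (k - l))"
    by (simp add: coeff_mult coeff_sum)
  show "0 \<le> coeff (coeff (P * Q) r) k"
    unfolding coeff using P Q by (intro sum_nonneg mult_nonneg_nonneg) (auto simp: weighted_def)
  assume "coeff (coeff (P * Q) r) k \<noteq> 0"
  then obtain i l where il: "i \<le> r" "l \<le> k" "coeff (coeff P i) l * coeff (coeff Q (r - i)) (k - l) \<noteq> 0"
    unfolding coeff by (meson atMost_iff sum.neutral)
  then have "coeff (coeff P i) l \<noteq> 0" "coeff (coeff Q (r - i)) (k - l) \<noteq> 0" by auto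
  then have "2 * l \<le> d + i" "2 * (k - l) \<le> e + (r - i)" using P Q unfolding weighted_def by blast+
  then show "2 * k \<le> d + e + r" using il by linarith
qed

lemma weighted_one: "weighted 0 1"
  by (simp add: weighted_def coeff_1)

lemma weighted_power: "weighted d Q \<Longrightarrow> weighted (n * d) (Q ^ n)"
  by (induction n) (use weighted_mult weighted_one in force)+

lemma weighted_sum: "(\<And>i. i \<in> A \<Longrightarrow> weighted d (f i)) \<Longrightarrow> weighted d (\<Sum>i\<in>A. f i)"
  by (induction A rule: infinite_finite_induct) (auto intro: weighted_add simp: weighted_def[of d 0])

text \<open>The terms x, 2xW and 4x^2W^2 have weights 2, 1 and 2, while 1 and 4xW have weights 0 and
  1. So each summand of the form has weight at most 2s + (2j - 2s) = 2j.\<close>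

lemma weighted_A_bipoly:
  assumes "\<And>s. 0 \<le> D s"
  shows "weighted (2 * j) (A_bipoly j D)"
proof -
  let ?x = "[:[:0, 1:]:] :: int poly poly" and ?W = "[:0, 1:] :: int poly poly"
  have "?x * (1 + 2 * ?W + 4 * ?x * ?W ^ 2) = [:[:0, 1:], [:0, 2:], [:0, 0, 4:]:]"
    by (simp add: power2_eq_square one_pCons numeral_poly)
  then have x: "weighted 2 (?x * (1 + 2 * ?W + 4 * ?x * ?W ^ 2))"
    by (auto simp: weighted_def coeff_pCons split: nat.splits)
  have "1 + 4 * ?x * ?W = [:1, [:0, 4:]:]"
    by (simp add: one_pCons numeral_poly)
  then have b: "weighted 1 (1 + 4 * ?x * ?W)"
    by (auto simp: weighted_def coeff_pCons coeff_1 split: nat.splits)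
  have D: "weighted 0 (of_int (D s))" for s
    using assms by (auto simp: weighted_def of_int_poly coeff_pCons split: nat.splits)
  show ?thesis
    unfolding A_bipoly_def Let_def qform_def
  proof (intro weighted_sum)
    fix s assume "s \<in> {..j}"
    then have *: "0 + s * 2 + (2 * j - 2 * s) * 1 = 2 * j" by auto
    show "weighted (2 * j) (of_int (D s) * (?x * (1 + 2 * ?W + 4 * ?x * ?W ^ 2)) ^ s *
        (1 + 4 * ?x * ?W) ^ (2 * j - 2 * s))"
      using weighted_mult[OF weighted_mult[OF D[of s] weighted_power[OF x, of s]] weighted_power[OF b, of "2 * j - 2 * s"]]
      unfolding * .
  qed
qed

section \<open>The expansion of \<open>F\<^sub>j\<^sub>,\<^sub>f\<close>\<close>

lemma fps_mult_one_minus_const_X_nth: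
  fixes F :: "'a :: comm_ring_1 fps"
  shows "(F * (1 - fps_const c * fps_X)) $ n = F $ n - (if n = 0 then 0 else c * F $ (n - 1))"
proof -
  have "F * (1 - fps_const c * fps_X) = F - fps_const c * (F * fps_X)"
    by (simp add: right_diff_distrib mult.left_commute)
  then show ?thesis by simp
qed

text \<open>With g = 1 / (1 - c X) and W = c X g, the powers of W expand into binomial coefficients:
  multiplying by 1 - c X in the induction step is Pascal's rule. This is the origin of (f choose r)
  in \<gamma>.\<close>

lemma fps_geometric_binomial:
  fixes c :: "'a :: comm_ring_1"
  assumes g: "g * (1 - fps_const c * fps_X) = 1"
  shows "g * (fps_const c * fps_X * g) ^ r = Abs_fps (\<lambda>f. of_nat (f choose r) * c ^ f)"
proof (induction r)
  case 0
  let ?S = "Abs_fps (\<lambda>f. c ^ f)" and ?d = "1 - fps_const c * fps_X"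
  have S: "?S * ?d = 1"
  proof (rule fps_ext)
    fix n show "(?S * ?d) $ n = 1 $ n"
      by (cases n) (auto simp: fps_mult_one_minus_const_X_nth)
  qed
  have "?S = ?S * (g * ?d)" by (simp only: g mult_1_right)
  also have "\<dots> = (?S * ?d) * g" by (simp only: ac_simps)
  also have "\<dots> = g" by (simp only: S mult_1_left)
  finally have "?S = g" .
  then show ?case by simp
next
  case (Suc r)
  let ?B = "\<lambda>r. Abs_fps (\<lambda>f. of_nat (f choose r) * c ^ f)"
  have "?B (Suc r) * (1 - fps_const c * fps_X) = fps_const c * fps_X * ?B r"
  proof (rule fps_ext)
    fix n show "(?B (Suc r) * (1 - fps_const c * fps_X)) $ n = (fps_const c * fps_X * ?B r) $ n"
      unfolding fps_mult_one_minus_const_X_nth mult.assoc by (cases n) (auto simp: algebra_simps)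
  qed
  then have "?B (Suc r) * ((1 - fps_const c * fps_X) * g) = fps_const c * fps_X * ?B r * g"
    by (simp only: mult.assoc[symmetric])
  then have "?B (Suc r) = fps_const c * fps_X * ?B r * g"
    using g by (simp only: mult.commute[of _ g] mult_1_right)
  also have "\<dots> = fps_const c * fps_X * (g * (fps_const c * fps_X * g) ^ r) * g"
    by (simp only: Suc.IH)
  also have "\<dots> = g * (fps_const c * fps_X * g) ^ Suc r"
    by (simp only: power_Suc ac_simps)
  finally show ?case by simp
qed

lemma weighted_degree_le:
  assumes "weighted d Q"
  shows "degree (coeff Q r) \<le> (d + r) div 2"
proof (rule degree_le)
  show "\<forall>i>(d + r) div 2. coeff (coeff Q r) i = 0"
  proof (intro allI impI, rule ccontr)
    fix i assume "(d + r) div 2 < i" "coeff (coeff Q r) i \<noteq> 0"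
    moreover from this have "2 * i \<le> d + r" using assms by (auto simp: weighted_def)
    ultimately show False by linarith
  qed
qed

lemma binomial_bipoly_eval:
  fixes g :: "'a :: comm_ring_1 fps" and Q :: "int poly poly"
  assumes g: "g * (1 - fps_const c * fps_X) = 1" and Q: "weighted d Q"
  shows "(g * poly (map_poly (\<lambda>p. poly (map_poly of_int p) (fps_const x)) Q) (fps_const c * fps_X * g)) $ f =
    c ^ f * (\<Sum>k\<le>(d + f) div 2. of_int (\<Sum>r\<le>f. coeff (coeff Q r) k * int (f choose r)) * x ^ k)"
proof -
  let ?e = "\<lambda>p :: int poly. poly (map_poly of_int p) (fps_const x)" and ?K = "(d + f) div 2"
  let ?W = "fps_const c * fps_X * g"
  have e0: "?e 0 = 0" by simp
  have e: "?e (coeff Q r) = fps_const (\<Sum>k\<le>?K. of_int (coeff (coeff Q r) k) * x ^ k)" if "r \<le> f" for r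
  proof -
    have "(d + r) div 2 \<le> ?K" using that by (intro div_le_mono) auto
    then have "degree (coeff Q r) \<le> ?K" using weighted_degree_le[OF Q, of r] by linarith
    then have "?e (coeff Q r) = (\<Sum>k\<le>?K. of_int (coeff (coeff Q r) k) * fps_const x ^ k)"
      by (rule poly_map_poly_of_int)
    also have "\<dots> = fps_const (\<Sum>k\<le>?K. of_int (coeff (coeff Q r) k) * x ^ k)"
      by (simp only: ring_hom_simps[OF is_ring_hom_fps_const])
    finally show ?thesis .
  qed
  have "poly (map_poly ?e Q) ?W = (\<Sum>r\<le>degree (map_poly ?e Q). ?e (coeff Q r) * ?W ^ r)"
    by (simp add: poly_altdef coeff_map_poly)
  \<comment> \<open>The range is padded with zero terms so that it surely contains all r up to
    \<open>f\<close>; the terms beyond \<open>f\<close> are dropped later because (f choose r) =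
    0.\<close>
  also have "\<dots> = (\<Sum>r\<le>degree (map_poly ?e Q) + f. ?e (coeff Q r) * ?W ^ r)"
  proof (rule sum.mono_neutral_left)
    show "\<forall>r\<in>{..degree (map_poly ?e Q) + f} - {..degree (map_poly ?e Q)}. ?e (coeff Q r) * ?W ^ r = 0"
    proof
      fix r assume "r \<in> {..degree (map_poly ?e Q) + f} - {..degree (map_poly ?e Q)}"
      then have "coeff (map_poly ?e Q) r = 0" by (intro coeff_eq_0) auto
      then show "?e (coeff Q r) * ?W ^ r = 0" by (simp add: coeff_map_poly)
    qed
  qed auto
  finally have "g * poly (map_poly ?e Q) ?W = (\<Sum>r\<le>degree (map_poly ?e Q) + f. ?e (coeff Q r) * (g * ?W ^ r))"
    by (simp add: sum_distrib_left mult.left_commute)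
  then have *: "g * poly (map_poly ?e Q) ?W =
      (\<Sum>r\<le>degree (map_poly ?e Q) + f. ?e (coeff Q r) * Abs_fps (\<lambda>f. of_nat (f choose r) * c ^ f))"
    by (simp only: fps_geometric_binomial[OF g])
  have small: "(?e (coeff Q r) * Abs_fps (\<lambda>f. of_nat (f choose r) * c ^ f)) $ f =
      (\<Sum>k\<le>?K. of_int (coeff (coeff Q r) k) * x ^ k) * (of_nat (f choose r) * c ^ f)" if "r \<le> f" for r
    by (simp add: e[OF that])
  have large: "(?e (coeff Q r) * Abs_fps (\<lambda>f. of_nat (f choose r) * c ^ f)) $ f = 0" if "r > f" for r
    unfolding fps_mult_nth using that by (intro sum.neutral) (auto simp: binomial_eq_0)
  have "(g * poly (map_poly ?e Q) ?W) $ f =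
      (\<Sum>r\<le>degree (map_poly ?e Q) + f. (?e (coeff Q r) * Abs_fps (\<lambda>f. of_nat (f choose r) * c ^ f)) $ f)"
    unfolding * by (rule fps_sum_nth)
  also have "\<dots> = (\<Sum>r\<le>f. (?e (coeff Q r) * Abs_fps (\<lambda>f. of_nat (f choose r) * c ^ f)) $ f)"
    by (rule sum.mono_neutral_right) (auto simp: large)
  also have "\<dots> = (\<Sum>r\<le>f. (\<Sum>k\<le>?K. of_int (coeff (coeff Q r) k) * x ^ k) * (of_nat (f choose r) * c ^ f))"
    by (intro sum.cong refl small) auto
  also have "\<dots> = (\<Sum>r\<le>f. \<Sum>k\<le>?K. c ^ f * (of_int (coeff (coeff Q r) k * int (f choose r)) * x ^ k))"
    by (simp add: sum_distrib_right sum_distrib_left ac_simps)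
  also have "\<dots> = (\<Sum>k\<le>?K. \<Sum>r\<le>f. c ^ f * (of_int (coeff (coeff Q r) k * int (f choose r)) * x ^ k))"
    by (rule sum.swap)
  also have "\<dots> = c ^ f * (\<Sum>k\<le>?K. of_int (\<Sum>r\<le>f. coeff (coeff Q r) k * int (f choose r)) * x ^ k)"
    by (simp add: sum_distrib_right sum_distrib_left)
  finally show ?thesis .
qed

text \<open>Put z = (1+a) b, so that W = z / (1 - z) and x = a / (1+a)^2. The arguments of the form,
  scaled by (1+a)(1-z), simplify through (1+a)^2 - 4a = (1-a)^2: for instance (1-z)^2 + 2z(1-z) +
  4ab^2 = 1 - (1-a)^2 b^2. The quadratic 1 + 2W + 4xW^2 and the factor 1 + 4xW are shaped to produce
  the right side of \<open>double_series\<close>.\<close>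

lemma qform_bipoly_eval:
  fixes a b y g :: "'a :: comm_ring_1"
  assumes y: "y * (1 + a) = 1" and g: "g * (1 - (1 + a) * b) = 1"
  defines "x \<equiv> a * y ^ 2" and "W \<equiv> (1 + a) * b * g"
  shows "((1 + a) * (1 - (1 + a) * b)) ^ (2 * j) * qform j D (x * (1 + 2 * W + 4 * x * W ^ 2)) (1 + 4 * x * W) =
    qform j D (a * (1 - ((1 - a) * b) ^ 2)) (1 + a - (1 - a) ^ 2 * b)"
proof -
  define z where "z = (1 + a) * b"
  have g': "(1 - z) * g = 1" using g by (simp add: z_def mult.commute)
  have x: "(1 + a) ^ 2 * x = a"
  proof -
    have "(1 + a) ^ 2 * x = a * (y * (1 + a)) ^ 2" by (simp add: x_def power_mult_distrib ac_simps)
    then show ?thesis by (simp add: y)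
  qed
  have W: "(1 - z) * W = z"
  proof -
    have "(1 - z) * W = z * ((1 - z) * g)" unfolding W_def z_def by (simp only: ac_simps)
    then show ?thesis by (simp add: g')
  qed
  have xz: "x * z ^ 2 = a * b ^ 2"
  proof -
    have "x * z ^ 2 = ((1 + a) ^ 2 * x) * b ^ 2" unfolding z_def power_mult_distrib by (simp only: ac_simps)
    then show ?thesis by (simp only: x)
  qed
  have xz1: "(1 + a) * (x * z) = a * b"
  proof -
    have "(1 + a) * (x * z) = ((1 + a) ^ 2 * x) * b" unfolding z_def power2_eq_square by (simp only: ac_simps)
    then show ?thesis by (simp only: x)
  qed
  have "((1 + a) * (1 - z)) ^ 2 * (x * (1 + 2 * W + 4 * x * W ^ 2)) =
      ((1 + a) ^ 2 * x) * ((1 - z) ^ 2 + 2 * (1 - z) * ((1 - z) * W) + 4 * (x * ((1 - z) * W) ^ 2))"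
    by (simp add: power_mult_distrib power2_eq_square algebra_simps)
  also have "\<dots> = a * ((1 - z) ^ 2 + 2 * (1 - z) * z + 4 * (a * b ^ 2))"
    by (simp only: x W xz)
  also have "\<dots> = a * (1 - ((1 - a) * b) ^ 2)"
    by (simp add: z_def power2_eq_square algebra_simps)
  finally have 1: "((1 + a) * (1 - z)) ^ 2 * (x * (1 + 2 * W + 4 * x * W ^ 2)) = a * (1 - ((1 - a) * b) ^ 2)" .
  have "((1 + a) * (1 - z)) * (1 + 4 * x * W) = (1 + a) * (1 - z) + 4 * ((1 + a) * (x * ((1 - z) * W)))"
    by (simp add: algebra_simps)
  also have "\<dots> = (1 + a) * (1 - z) + 4 * (a * b)" by (simp only: W xz1)
  also have "\<dots> = 1 + a - (1 - a) ^ 2 * b" by (simp add: z_def power2_eq_square algebra_simps)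
  finally show ?thesis using 1 unfolding qform_scale z_def by simp
qed

lemma F_cyc_fix_expansion:
  assumes P: "is_P j P" and nonneg: "\<And>s. 0 \<le> coeff P s"
  shows "F_cyc_fix j f = (\<Sum>k\<le>(2 * j + f) div 2.
    smult (\<Sum>r\<le>f. coeff (coeff (A_bipoly j (coeff P)) r) k * int (f choose r))
      ([:0, 1:] ^ k * [:1, 1:] ^ (2 * j + f - 2 * k)))"
    (is "_ = (\<Sum>k\<le>_. smult (?\<gamma> k) _)")
proof -
  let ?D = "coeff P" and ?Q = "A_bipoly j (coeff P)"
  define a where "a = (fps_const fps_X :: int fps fps)"
  define G where "G = Abs_fps (\<lambda>m. int (card (symmetric_msets (2 * j) 0 m)))"
  define C where "C m = Abs_fps (\<lambda>f. int (card (fixed_msets f m)))" for m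
  have "G * (1 - fps_X) ^ (2 * j + 1) = fps_of_poly (J_B j)"
    using F_cyc_fix_series[of j 0] by (simp add: G_def J_B_def)
  also have "\<dots> = qform j ?D fps_X (1 + fps_X)"
    using P by (simp add: is_P_iff qform_hom[OF is_ring_hom_fps_of_poly] fps_of_poly_linear)
  finally have G: "G * (1 - fps_X) ^ (2 * j + 1) = qform j ?D fps_X (1 + fps_X)" .
  have C: "C m * (1 - fps_X) ^ (m + 1) = (1 + fps_X) ^ m" for m
    unfolding C_def by (rule fixed_msets_series)
  \<comment> \<open>By \<open>card_symmetric_msets\<close> the products
    \<open>G $ m * C m $ f\<close> count the symmetric multisets with \<open>f\<close> fixed cells,
    so the coefficient of v^f in \<Phi> is F_{j,f}.\<close>
  define \<Phi> where "\<Phi> = Abs_fps (\<lambda>f. Abs_fps (\<lambda>m. G $ m * C m $ f) * (1 - fps_X) ^ (2 * j + f + 1))"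
  have \<Phi>_nth: "\<Phi> $ f = fps_of_poly (F_cyc_fix j f)"
    using F_cyc_fix_series[of j f] by (simp add: \<Phi>_def G_def C_def card_symmetric_msets)
  \<comment> \<open>\<open>y\<close> is 1 / (1+t), so \<open>x\<close> below becomes t / (1+t)^2;
    \<open>g\<close> is 1 / (1 - (1+t) v).\<close>
  define y :: "int fps" where "y = Abs_fps (\<lambda>i. (- 1) ^ i)"
  have y: "y * (1 + fps_X) = 1"
  proof (rule fps_ext)
    fix n show "(y * (1 + fps_X)) $ n = 1 $ n" by (cases n) (auto simp: y_def distrib_left)
  qed
  define g where "g = Abs_fps (\<lambda>i. (1 + fps_X :: int fps) ^ i)"
  have g: "g * (1 - fps_const (1 + fps_X) * fps_X) = 1"
  proof (rule fps_ext)
    fix n show "(g * (1 - fps_const (1 + fps_X) * fps_X)) $ n = 1 $ n"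
      unfolding fps_mult_one_minus_const_X_nth by (cases n) (auto simp: g_def)
  qed
  have one_a: "fps_const (1 + fps_X) = 1 + a"
    unfolding a_def by (simp only: ring_hom_simps[OF is_ring_hom_fps_const])
  have ya: "fps_const y * (1 + a) = 1"
    using arg_cong[OF y, of fps_const] by (simp only: ring_hom_simps[OF is_ring_hom_fps_const] a_def)
  define x where "x = fps_X * y ^ 2"
  have x: "fps_const x = a * fps_const y ^ 2"
    unfolding x_def a_def by (simp only: ring_hom_simps[OF is_ring_hom_fps_const])
  define W where "W = fps_const (1 + fps_X) * fps_X * g"
  let ?e = "\<lambda>p :: int poly. poly (map_poly of_int p) (fps_const x)"
  have "is_ring_hom (of_int :: int \<Rightarrow> int fps fps)" by (simp add: is_ring_hom_def)
  then have hom_e: "is_ring_hom ?e" by (rule is_ring_hom_poly_map_poly)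
  then have hom_E: "is_ring_hom (\<lambda>Q. poly (map_poly ?e Q) W)" by (rule is_ring_hom_poly_map_poly)
  have "poly (map_poly ?e [:[:0, 1:]:]) W = fps_const x" "poly (map_poly ?e [:0, 1:]) W = W"
    by (simp_all add: map_poly_pCons ring_hom_simps[OF hom_e])
  then have eval: "poly (map_poly ?e ?Q) W =
      qform j ?D (fps_const x * (1 + 2 * W + 4 * fps_const x * W ^ 2)) (1 + 4 * fps_const x * W)"
    unfolding A_bipoly_def Let_def by (simp only: qform_hom[OF hom_E] ring_hom_simps[OF hom_E])
  \<comment> \<open>\<Psi> is the conjectured expansion: its v^f coefficient is read off by
    \<open>binomial_bipoly_eval\<close>. It is compared with \<Phi> after multiplication by a power
    of the unit 1 - (1+t) v.\<close>
  define \<Psi> where "\<Psi> = (1 + a) ^ (2 * j) * (g * poly (map_poly ?e ?Q) W)"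
  have ga: "g * (1 - (1 + a) * fps_X) = 1" using g unfolding one_a .
  let ?d = "1 - (1 + a) * fps_X"
  have "\<Psi> * ?d ^ (2 * j + 1) = (g * ?d) * (((1 + a) * ?d) ^ (2 * j) * poly (map_poly ?e ?Q) W)"
    by (simp add: \<Psi>_def power_mult_distrib ac_simps)
  also have "\<dots> = qform j ?D (a * (1 - ((1 - a) * fps_X) ^ 2)) (1 + a - (1 - a) ^ 2 * fps_X)"
    unfolding eval unfolding ga x W_def one_a by (simp only: qform_bipoly_eval[OF ya ga] mult_1_left)
  also have "\<dots> = \<Phi> * ?d ^ (2 * j + 1)"
    unfolding \<Phi>_def a_def by (rule double_series[OF G C, symmetric])
  finally have eq: "\<Psi> * ?d ^ (2 * j + 1) = \<Phi> * ?d ^ (2 * j + 1)" .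
  have "F * ?d ^ (2 * j + 1) * g ^ (2 * j + 1) = F" for F
    by (simp only: mult.assoc power_mult_distrib[symmetric] mult.commute[of ?d g] ga power_one mult_1_right)
  with eq have "\<Psi> = \<Phi>" by metis
  have "weighted (2 * j) ?Q" using weighted_A_bipoly nonneg by blast
  have one_a_power: "(1 + a) ^ (2 * j) = fps_const ((1 + fps_X) ^ (2 * j))"
    unfolding one_a[symmetric] by (simp only: ring_hom_power[OF is_ring_hom_fps_const])
  have "fps_of_poly (F_cyc_fix j f) = \<Psi> $ f" unfolding \<open>\<Psi> = \<Phi>\<close> \<Phi>_nth ..
  also have "\<dots> = (1 + fps_X) ^ (2 * j) * (g * poly (map_poly ?e ?Q) W) $ f"
    by (simp add: \<Psi>_def one_a_power)
  also have "\<dots> = (1 + fps_X) ^ (2 * j) * ((1 + fps_X) ^ f * (\<Sum>k\<le>(2 * j + f) div 2. of_int (?\<gamma> k) * x ^ k))"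
    unfolding W_def by (simp only: binomial_bipoly_eval[OF g \<open>weighted (2 * j) ?Q\<close>])
  also have "\<dots> = (\<Sum>k\<le>(2 * j + f) div 2. of_int (?\<gamma> k) * ((1 + fps_X) ^ (2 * j + f) * x ^ k))"
    by (simp only: power_add sum_distrib_left ac_simps)
  also have "\<dots> = (\<Sum>k\<le>(2 * j + f) div 2. of_int (?\<gamma> k) * (fps_X ^ k * (1 + fps_X) ^ (2 * j + f - 2 * k)))"
  proof (intro sum.cong refl)
    fix k assume "k \<in> {..(2 * j + f) div 2}"
    then have "2 * j + f = (2 * j + f - 2 * k) + 2 * k" by auto
    \<comment> \<open>The bound on k leaves enough factors 1 + t to cancel the denominator
      (1+t)^(2k) of x^k.\<close>
    then have "(1 + fps_X) ^ (2 * j + f) * x ^ k =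
        (1 + fps_X) ^ (2 * j + f - 2 * k) * (1 + fps_X) ^ (2 * k) * (fps_X * y ^ 2) ^ k"
      unfolding x_def by (metis power_add)
    also have "\<dots> = (1 + fps_X) ^ (2 * j + f - 2 * k) * fps_X ^ k * (y * (1 + fps_X)) ^ (2 * k)"
      by (simp only: power_mult_distrib power_mult[symmetric] ac_simps)
    also have "\<dots> = fps_X ^ k * (1 + fps_X) ^ (2 * j + f - 2 * k)" by (simp only: y power_one mult_1_right) (rule mult.commute)
    finally show "of_int (?\<gamma> k) * ((1 + fps_X) ^ (2 * j + f) * x ^ k) =
        of_int (?\<gamma> k) * (fps_X ^ k * (1 + fps_X) ^ (2 * j + f - 2 * k))" by simp
  qed
  also have "\<dots> = fps_of_poly (\<Sum>k\<le>(2 * j + f) div 2. of_int (?\<gamma> k) * ([:0, 1:] ^ k * [:1, 1:] ^ (2 * j + f - 2 * k)))"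
    by (simp only: ring_hom_simps[OF is_ring_hom_fps_of_poly] fps_of_poly_linear)
  finally have "F_cyc_fix j f = (\<Sum>k\<le>(2 * j + f) div 2. of_int (?\<gamma> k) * ([:0, 1:] ^ k * [:1, 1:] ^ (2 * j + f - 2 * k)))"
    by (simp only: fps_of_poly_eq_iff)
  then show ?thesis by (simp add: of_int_poly)
qed

section \<open>Assembly of the full descent polynomial\<close>

lemma smult_sum_right: "smult c (\<Sum>i\<in>S. f i) = (\<Sum>i\<in>S. smult c (f i))"
  by (induction S rule: infinite_finite_induct) (simp_all add: smult_add_right)

text \<open>Involutions are grouped by their number j of two-cycles. Each group has exactly n - 2j
  fixed points, so p^(n-2j) factors out; \<open>map_poly\<close> regards the integer coefficients as
  constants in p.\<close>

lemma F_inv_eq: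
  "F_inv n = (\<Sum>j\<le>n div 2. smult (monom 1 (n - 2 * j)) (map_poly (\<lambda>c. [:c:]) (F_cyc_fix j (n - 2 * j))))"
proof -
  have F: "smult (monom 1 (n - 2 * j)) (map_poly (\<lambda>c. [:c:]) (F_cyc_fix j (n - 2 * j))) =
      (\<Sum>\<pi> | \<pi> \<in> involutions_B n \<and> cyc2 n \<pi> = j. monom (monom 1 (fix_B n \<pi>)) (des_B n \<pi>))"
    if "j \<le> n div 2" for j
  proof -
    have n: "2 * j + (n - 2 * j) = n" using that by auto
    have lift_sum: "map_poly (\<lambda>c. [:c:]) (\<Sum>x\<in>A. f x) = (\<Sum>x\<in>A. map_poly (\<lambda>c. [:c:]) (f x))" for f :: "_ \<Rightarrow> int poly" and A
      by (rule poly_eqI) (simp add: coeff_map_poly coeff_sum ring_hom_sum[OF is_ring_hom_const_poly])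
    have "smult (monom 1 (n - 2 * j)) (map_poly (\<lambda>c. [:c:]) (F_cyc_fix j (n - 2 * j))) =
       (\<Sum>\<pi> | \<pi> \<in> involutions_B n \<and> fix_B n \<pi> = n - 2 * j. monom (monom 1 (n - 2 * j)) (des_B n \<pi>))"
      by (simp add: F_cyc_fix_eq n lift_sum map_poly_monom smult_sum_right smult_monom)
    also have "\<dots> = (\<Sum>\<pi> | \<pi> \<in> involutions_B n \<and> cyc2 n \<pi> = j. monom (monom 1 (fix_B n \<pi>)) (des_B n \<pi>))"
    proof (rule sum.cong)
      show "{\<pi> \<in> involutions_B n. fix_B n \<pi> = n - 2 * j} = {\<pi> \<in> involutions_B n. cyc2 n \<pi> = j}"
      proof (intro Collect_cong conj_cong refl)
        fix \<pi> assume "\<pi> \<in> involutions_B n"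
        from fix_B_plus_cyc2[OF this] n show "fix_B n \<pi> = n - 2 * j \<longleftrightarrow> cyc2 n \<pi> = j" by linarith
      qed
      show "monom (monom 1 (n - 2 * j)) (des_B n \<pi>) = monom (monom 1 (fix_B n \<pi>)) (des_B n \<pi>)"
        if "\<pi> \<in> {\<pi> \<in> involutions_B n. cyc2 n \<pi> = j}" for \<pi>
      proof -
        have "fix_B n \<pi> + 2 * j = n" using fix_B_plus_cyc2[of \<pi> n] that by auto
        then have "n - 2 * j = fix_B n \<pi>" by linarith
        then show ?thesis by simp
      qed
    qed
    finally show ?thesis .
  qed
  have "F_inv n = (\<Sum>j\<le>n div 2. \<Sum>\<pi> | \<pi> \<in> involutions_B n \<and> cyc2 n \<pi> = j. monom (monom 1 (fix_B n \<pi>)) (des_B n \<pi>))"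
    unfolding F_inv_def
  proof (rule sum.group[symmetric])
    show "cyc2 n ` involutions_B n \<subseteq> {..n div 2}"
      using fix_B_plus_cyc2[of _ n] by fastforce
  qed (simp_all add: finite_involutions_B)
  also have "\<dots> = (\<Sum>j\<le>n div 2. smult (monom 1 (n - 2 * j)) (map_poly (\<lambda>c. [:c:]) (F_cyc_fix j (n - 2 * j))))"
    by (intro sum.cong refl F[symmetric]) auto
  finally show ?thesis .
qed

lemma is_ring_hom_map_poly_const: "is_ring_hom (map_poly (\<lambda>c. [:c:]) :: int poly \<Rightarrow> int poly poly)"
proof -
  have "map_poly (\<lambda>c. [:c:]) (p * q) = map_poly (\<lambda>c. [:c:]) p * map_poly (\<lambda>c. [:c:]) (q :: int poly)" for p q
    by (rule poly_eqI) (simp add: coeff_map_poly coeff_mult ring_hom_sum[OF is_ring_hom_const_poly] mult.commute)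
  moreover have "map_poly (\<lambda>c. [:c:]) (p + q) = map_poly (\<lambda>c. [:c:]) p + map_poly (\<lambda>c. [:c:]) (q :: int poly)" for p q
    by (rule poly_eqI) (simp add: coeff_map_poly)
  moreover have "map_poly (\<lambda>c. [:c:]) (1 :: int poly) = 1"
    by (rule map_poly_1') (simp add: one_pCons)
  ultimately show ?thesis by (simp add: is_ring_hom_def)
qed

theorem corollary1p3:
  assumes Wan_Gao_Li_Yang: "\<forall>j. \<exists>P. is_P j P \<and> (\<forall>s. coeff P s \<in> \<nat>)"
  shows
    "(\<forall>j f.
        (\<forall>k. 2 * k > 2 * j + f \<longrightarrow> gamma_coeff j f k = 0) \<and>
        F_cyc_fix j f =
          (\<Sum>k = 0..(2 * j + f) div 2.
             smult (gamma_coeff j f k) ([:0, 1:] ^ k * [:1, 1:] ^ (2 * j + f - 2 * k)))) \<and>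
     (\<forall>j k r. A_coeff j k r \<in> \<nat>) \<and>
     (\<forall>n. \<exists>C :: nat \<Rightarrow> int poly.
        (\<forall>k m. coeff (C k) m \<in> \<nat>) \<and>
        F_inv n =
          (\<Sum>k = 0..n div 2. smult (C k) ([:0, 1:] ^ k * [:1, 1:] ^ (n - 2 * k))))"
proof -
  obtain P where P: "\<And>j. is_P j (P j)" and "\<And>j s. coeff (P j) s \<in> \<nat>"
    using Wan_Gao_Li_Yang by metis
  then have P_nonneg: "0 \<le> coeff (P j) s" for j s
    by (metis Nats_cases of_nat_0_le_iff)
  have A_coeff_eq: "A_coeff j k r = coeff (coeff (A_bipoly j (coeff (P j))) r) k" for j k r
    by (simp add: A_coeff_def A_poly_eq[OF P])
  have weighted: "weighted (2 * j) (A_bipoly j (coeff (P j)))" for j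
    by (rule weighted_A_bipoly) (rule P_nonneg)
  have A_nonneg: "0 \<le> A_coeff j k r" for j k r
    using weighted[of j] by (simp add: A_coeff_eq weighted_def)
  have A_zero: "A_coeff j k r = 0" if "2 * k > 2 * j + r" for j k r
  proof (rule ccontr)
    assume "A_coeff j k r \<noteq> 0"
    then have "2 * k \<le> 2 * j + r" using weighted[of j] unfolding A_coeff_eq weighted_def by blast
    then show False using that by linarith
  qed
  \<comment> \<open>Only r up to f enters \<gamma>, and each A_{j,k,r} with 2k > 2j + r vanishes by
    the weight bound.\<close>
  have gamma_zero: "gamma_coeff j f k = 0" if "2 * k > 2 * j + f" for j f k
    unfolding gamma_coeff_def using that by (intro sum.neutral) (auto simp: A_zero)
  have gamma_nonneg: "0 \<le> gamma_coeff j f k" for j f k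
    unfolding gamma_coeff_def by (intro sum_nonneg mult_nonneg_nonneg A_nonneg) auto
  have F: "F_cyc_fix j f = (\<Sum>k = 0..(2 * j + f) div 2.
      smult (gamma_coeff j f k) ([:0, 1:] ^ k * [:1, 1:] ^ (2 * j + f - 2 * k)))" for j f
    unfolding F_cyc_fix_expansion[OF P P_nonneg, of j f] gamma_coeff_def A_coeff_eq atMost_atLeast0 ..
  have "\<exists>C :: nat \<Rightarrow> int poly. (\<forall>k m. coeff (C k) m \<in> \<nat>) \<and>
      F_inv n = (\<Sum>k = 0..n div 2. smult (C k) ([:0, 1:] ^ k * [:1, 1:] ^ (n - 2 * k)))" for n
  proof (intro exI conjI allI)
    \<comment> \<open>C_{n,k}(p) is the sum over j of \<gamma>_{j,n-2j,k} p^(n-2j), obtained by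
      exchanging the sums over j and k; the range of k is the same for all j because 2j + (n - 2j) =
      n.\<close>
    let ?C = "\<lambda>k. \<Sum>j\<le>n div 2. monom (gamma_coeff j (n - 2 * j) k) (n - 2 * j)"
    show "coeff (?C k) m \<in> \<nat>" for k m
      by (simp add: coeff_sum Nats_altdef1 int_eq_iff sum_nonneg gamma_nonneg)
    let ?h = "map_poly (\<lambda>c. [:c:]) :: int poly \<Rightarrow> int poly poly"
    note h_simps = ring_hom_simps[OF is_ring_hom_map_poly_const]
    let ?b = "\<lambda>k. [:0, 1:] ^ k * [:1, 1:] ^ (n - 2 * k) :: int poly poly"
    have lift: "smult (monom 1 (n - 2 * j)) (?h (F_cyc_fix j (n - 2 * j))) =
        (\<Sum>k = 0..n div 2. smult (monom (gamma_coeff j (n - 2 * j) k) (n - 2 * j)) (?b k))"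
      if "j \<le> n div 2" for j
    proof -
      have n: "2 * j + (n - 2 * j) = n" using that by auto
      have "?h [:0, 1:] = [:0, 1:]" "?h [:1, 1:] = [:1, 1:]"
        by (simp_all add: map_poly_pCons one_pCons)
      then have "?h (smult c ([:0, 1:] ^ k * [:1, 1:] ^ (n - 2 * k))) = smult [:c:] (?b k)" for c k
        by (simp add: map_poly_smult h_simps)
      then show ?thesis
        unfolding F n by (simp add: h_simps smult_sum_right smult_monom monom_altdef)
    qed
    have "F_inv n = (\<Sum>j\<le>n div 2. \<Sum>k = 0..n div 2. smult (monom (gamma_coeff j (n - 2 * j) k) (n - 2 * j)) (?b k))"
      unfolding F_inv_eq by (intro sum.cong refl lift) auto
    also have "\<dots> = (\<Sum>k = 0..n div 2. smult (?C k) (?b k))"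
      by (subst sum.swap) (simp add: smult_sum)
    finally show "F_inv n = (\<Sum>k = 0..n div 2. smult (?C k) (?b k))" .
  qed
  then show ?thesis
    using gamma_zero F A_nonneg by (auto simp: Nats_altdef1 zero_le_imp_eq_int)
qed

end
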